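(* Assume that $\int_{\mathcal{X}}|f|\,dP$ is finite for all $f\in\mathcal{F}$. Then the convex conjugate function $$f\in\langle\mathcal{F}\cup\mathcal{B}_b\rangle\mapsto\phi^*(f):=\sup_{Q\in\mathcal{M}_{\mathcal{F}}(P)}\left\{\int f\,dQ-\phi(Q,P)\right\}\in(-\infty,+\infty]$$ is proper, it can be expressed by $$\phi^*(f)=\int\varphi^*(f)\,dP\quad\text{for all }f\in\langle\mathcal{F}\cup\mathcal{B}_b\rangle,$$ and the $\phi$-divergence $\phi(Q,P)$ admits the dual representation $$\phi(Q,P)=\sup_{f\in\langle\mathcal{F}\cup\mathcal{B}_b\rangle}\left\{\int f\,dQ-\int\varphi^*(f)\,dP\right\}\quad\text{for all }Q\in\mathcal{M}_{\mathcal{F}}(P).$$ In particular, the function $Q\in[\mathcal{M}_{\mathcal{F}}(P);\tau_{\mathcal{F}}]\mapsto\phi(Q,P)\in[0,+\infty]$ is lower semi-continuous.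
   Context: $(\mathcal{X},\mathcal{B})$ is a measurable space and $P$ a given probability measure on it. $\mathcal{M}$ is the real vector space of all signed finite measures on $(\mathcal{X},\mathcal{B})$, and $\mathcal{M}(P)$ the subspace of those absolutely continuous w.r.t. $P$. The function $\varphi:\mathbb{R}\to[0,+\infty]$ is proper, convex and closed, with $\varphi(1)=0$, and its domain $\{x:\varphi(x)<\infty\}$ is an interval with endpoints $a_\varphi<1<b_\varphi$ (finite or infinite). Closed means that $\varphi(x)\to\varphi(a_\varphi)$ as $x\downarrow a_\varphi$ if $a_\varphi$ is finite, and $\varphi(x)\to\varphi(b_\varphi)$ as $x\uparrow b_\varphi$ if $b_\varphi$ is finite (equivalently, $\varphi$ is lower semi-continuous). The conjugate is $\varphi^*(t):=\sup_{x\in\mathbb{R}}\{tx-\varphi(x)\}$. For $Q\in\mathcal{M}(P)$ put $\phi(Q,P):=\int_{\mathcal{X}}\varphi\left(\frac{dQ}{dP}\right)dP$. $\mathcal{F}$ is a class (not assumed finite) of measurable real valued functions on $\mathcal{X}$; $\mathcal{B}_b$ is the set of all bounded measurable real valued functions on $\mathcal{X}$; $\langle\mathcal{F}\cup\mathcal{B}_b\rangle$ is the linear span of $\mathcal{F}\cup\mathcal{B}_b$; $\mathcal{M}_{\mathcal{F}}(P):=\{Q\in\mathcal{M}(P):\int|f|\,d|Q|<\infty\text{ for all }f\in\mathcal{F}\}$, where $|Q|$ is the total variation of $Q$. $\tau_{\mathcal{F}}$ is the weakest topology for which all maps $Q\mapsto\int f\,dQ$, $f\in\mathcal{F}\cup\mathcal{B}_b$,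 are continuous. A function with values in $(-\infty,+\infty]$ is proper if it is finite at some point. *)

theory Defs
  imports "HOL-Probability.Probability" "HOL-Library.Function_Algebras"
begin

section \<open>Finite signed measures\<close>

text \<open>
  A finite signed measure on \<open>(space M, sets M)\<close> is a real-valued countably additive set function
  (applied to the constantly empty sequence, countable additivity forces \<open>Q {} = 0\<close>). Only the
  measurable space underlying \<open>M\<close> matters. Values outside \<open>sets M\<close> are fixed to be \<open>0\<close>, so that
  equality of functions is equality of signed measures.
\<close>

definition signed_measures :: "'a measure \<Rightarrow> ('a set \<Rightarrow> real) set" where
  "signed_measures M =
    {Q. (\<forall>A :: nat \<Rightarrow> 'a set. range A \<subseteq> sets M \<longrightarrow> disjoint_family A \<longrightarrow>
            (\<lambda>i. Q (A i)) sums Q (\<Union>i. A i)) \<and>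
        (\<forall>A. A \<notin> sets M \<longrightarrow> Q A = 0)}"

text \<open>
  Jordan decomposition. Since \<open>B = {}\<close> is admitted in the suprema and \<^const>\<open>ennreal\<close> maps negative
  numbers to \<open>0\<close>, these are the usual upper and lower variations \<open>sup {Q B | B \<subseteq> A}\<close> and
  \<open>sup {- Q B | B \<subseteq> A}\<close>.
\<close>

definition pos_variation :: "'a measure \<Rightarrow> ('a set \<Rightarrow> real) \<Rightarrow> 'a measure" where
  "pos_variation M Q =
    measure_of (space M) (sets M) (\<lambda>A. SUP B \<in> {B \<in> sets M. B \<subseteq> A}. ennreal (Q B))"

definition neg_variation :: "'a measure \<Rightarrow> ('a set \<Rightarrow> real) \<Rightarrow> 'a measure" where
  "neg_variation M Q =
    measure_of (space M) (sets M) (\<lambda>A. SUP B \<in> {B \<in> sets M. B \<subseteq> A}. ennreal (- Q B))"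

definition total_variation :: "'a measure \<Rightarrow> ('a set \<Rightarrow> real) \<Rightarrow> 'a measure" where
  "total_variation M Q =
    measure_of (space M) (sets M)
      (\<lambda>A. emeasure (pos_variation M Q) A + emeasure (neg_variation M Q) A)"

definition signed_integral :: "'a measure \<Rightarrow> ('a set \<Rightarrow> real) \<Rightarrow> ('a \<Rightarrow> real) \<Rightarrow> real" where
  "signed_integral M Q f =
    integral\<^sup>L (pos_variation M Q) f - integral\<^sup>L (neg_variation M Q) f"

definition ac_signed_measures :: "'a measure \<Rightarrow> ('a set \<Rightarrow> real) set" where
  "ac_signed_measures P = {Q \<in> signed_measures P. \<forall>A \<in> null_sets P. Q A = 0}"

text \<open>The density \<open>dQ/dP\<close>; it is unique up to \<open>P\<close>-null sets.\<close>

definition signed_RN_deriv :: "'a measure \<Rightarrow> ('a set \<Rightarrow> real) \<Rightarrow> 'a \<Rightarrow> real" where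
  "signed_RN_deriv P Q =
    (SOME g. integrable P g \<and> (\<forall>A \<in> sets P. Q A = (LINT x:A|P. g x)))"


section \<open>Divergence functions\<close>

definition eff_domain :: "(real \<Rightarrow> ennreal) \<Rightarrow> real set" where
  "eff_domain \<phi> = {x. \<phi> x < \<infinity>}"

definition lower_end :: "(real \<Rightarrow> ennreal) \<Rightarrow> ereal" where
  "lower_end \<phi> = (INF x \<in> eff_domain \<phi>. ereal x)"

definition upper_end :: "(real \<Rightarrow> ennreal) \<Rightarrow> ereal" where
  "upper_end \<phi> = (SUP x \<in> eff_domain \<phi>. ereal x)"

definition ennreal_convex :: "(real \<Rightarrow> ennreal) \<Rightarrow> bool" where
  "ennreal_convex \<phi> \<longleftrightarrow>
    (\<forall>x y u. 0 \<le> u \<longrightarrow> u \<le> 1 \<longrightarrow>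
       \<phi> (u * x + (1 - u) * y) \<le> ennreal u * \<phi> x + ennreal (1 - u) * \<phi> y)"

definition closed_at_ends :: "(real \<Rightarrow> ennreal) \<Rightarrow> bool" where
  "closed_at_ends \<phi> \<longleftrightarrow>
    (\<forall>a. lower_end \<phi> = ereal a \<longrightarrow> (\<phi> \<longlongrightarrow> \<phi> a) (at_right a)) \<and>
    (\<forall>b. upper_end \<phi> = ereal b \<longrightarrow> (\<phi> \<longlongrightarrow> \<phi> b) (at_left b))"

text \<open>
  Properness (\<open>eff_domain \<phi> \<noteq> {}\<close>) and \<open>is_interval (eff_domain \<phi>)\<close> follow from the other conditions;
  they are listed to keep the definition explicit.
\<close>

definition divergence_function :: "(real \<Rightarrow> ennreal) \<Rightarrow> bool" where
  "divergence_function \<phi> \<longleftrightarrow>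
    eff_domain \<phi> \<noteq> {} \<and> ennreal_convex \<phi> \<and> closed_at_ends \<phi> \<and> \<phi> 1 = 0 \<and>
    is_interval (eff_domain \<phi>) \<and> lower_end \<phi> < 1 \<and> 1 < upper_end \<phi>"

definition conjugate :: "(real \<Rightarrow> ennreal) \<Rightarrow> real \<Rightarrow> ereal" where
  "conjugate \<phi> t = (SUP x. ereal (t * x) - enn2ereal (\<phi> x))"

definition divergence :: "(real \<Rightarrow> ennreal) \<Rightarrow> ('a set \<Rightarrow> real) \<Rightarrow> 'a measure \<Rightarrow> ennreal" where
  "divergence \<phi> Q P = (\<integral>\<^sup>+ x. \<phi> (signed_RN_deriv P Q x) \<partial>P)"

text \<open>
  Integral of an extended-real function, as the integral of its positive part minus that of its
  negative part. It is used only when the latter is finite, see \<open>conjugate_neg_part_finite\<close> below;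
  the convention of \<^typ>\<open>ereal\<close> for \<open>\<infinity> - \<infinity>\<close> plays no role.
\<close>

definition ereal_integral :: "'a measure \<Rightarrow> ('a \<Rightarrow> ereal) \<Rightarrow> ereal" where
  "ereal_integral M g =
    enn2ereal (\<integral>\<^sup>+ x. e2ennreal (g x) \<partial>M) - enn2ereal (\<integral>\<^sup>+ x. e2ennreal (- g x) \<partial>M)"

lemma conjugate_ge:
  assumes "\<phi> 1 = 0"
  shows "ereal t \<le> conjugate \<phi> t"
proof -
  have "ereal (t * 1) - enn2ereal (\<phi> 1) \<le> conjugate \<phi> t"
    unfolding conjugate_def by (rule SUP_upper) simp
  then show ?thesis
    using assms by (simp add: zero_ennreal.rep_eq)
qed

lemma conjugate_neg_part_finite:
  assumes "\<phi> 1 = 0" and "integrable P f"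
  shows "(\<integral>\<^sup>+ x. e2ennreal (- conjugate \<phi> (f x)) \<partial>P) < \<infinity>"
proof -
  have "e2ennreal (- conjugate \<phi> (f x)) \<le> ennreal \<bar>f x\<bar>" for x
  proof -
    have "- conjugate \<phi> (f x) \<le> ereal \<bar>f x\<bar>"
      using conjugate_ge[where \<phi> = \<phi> and t = "f x", OF assms(1)]
      by (cases "conjugate \<phi> (f x)") auto
    then have "e2ennreal (- conjugate \<phi> (f x)) \<le> e2ennreal (ereal \<bar>f x\<bar>)"
      by (rule e2ennreal_mono)
    then show ?thesis
      by (simp add: ennreal_def e2ennreal_def sup_absorb2 max_def)
  qed
  then have "(\<integral>\<^sup>+ x. e2ennreal (- conjugate \<phi> (f x)) \<partial>P) \<le> (\<integral>\<^sup>+ x. ennreal \<bar>f x\<bar> \<partial>P)"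
    by (intro nn_integral_mono)
  also have "\<dots> < \<infinity>"
    using assms(2) by (simp add: integrable_iff_bounded)
  finally show ?thesis .
qed


section \<open>Test functions, and the topology they induce\<close>

interpretation fun_space: vector_space "\<lambda>(c::real) (f :: 'a \<Rightarrow> real) x. c * f x"
  by unfold_locales (auto simp: fun_eq_iff algebra_simps)

definition bounded_measurable :: "'a measure \<Rightarrow> ('a \<Rightarrow> real) set" where
  "bounded_measurable M = {f \<in> borel_measurable M. \<exists>C. \<forall>x \<in> space M. \<bar>f x\<bar> \<le> C}"

definition test_functions :: "'a measure \<Rightarrow> ('a \<Rightarrow> real) set \<Rightarrow> ('a \<Rightarrow> real) set" where
  "test_functions M F = fun_space.span (F \<union> bounded_measurable M)"

definition MF :: "'a measure \<Rightarrow> ('a \<Rightarrow> real) set \<Rightarrow> ('a set \<Rightarrow> real) set" where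
  "MF P F = {Q \<in> ac_signed_measures P.
     \<forall>f \<in> F. (\<integral>\<^sup>+ x. ennreal \<bar>f x\<bar> \<partial>(total_variation P Q)) < \<infinity>}"

definition tauF :: "'a measure \<Rightarrow> ('a \<Rightarrow> real) set \<Rightarrow> ('a set \<Rightarrow> real) topology" where
  "tauF P F = topology_generated_by
     {{Q \<in> MF P F. signed_integral P Q f \<in> U} | f U.
        f \<in> F \<union> bounded_measurable P \<and> open (U :: real set)}"

lemma topspace_tauF: "topspace (tauF P F) = MF P F"
proof -
  have "(\<lambda>_. 0) \<in> F \<union> bounded_measurable P"
    by (auto simp: bounded_measurable_def)
  then have "MF P F \<in> {{Q \<in> MF P F. signed_integral P Q f \<in> U} | f U.
        f \<in> F \<union> bounded_measurable P \<and> open (U :: real set)}"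
    by (intro CollectI exI[of _ "\<lambda>_. 0"] exI[of _ UNIV]) auto
  then show ?thesis
    unfolding tauF_def topology_generated_by_topspace by blast
qed

definition lower_semicontinuous_map :: "'b topology \<Rightarrow> ('b \<Rightarrow> 'c :: linorder) \<Rightarrow> bool" where
  "lower_semicontinuous_map X h \<longleftrightarrow> (\<forall>c. openin X {x \<in> topspace X. c < h x})"

definition divergence_conjugate ::
    "(real \<Rightarrow> ennreal) \<Rightarrow> 'a measure \<Rightarrow> ('a \<Rightarrow> real) set \<Rightarrow> ('a \<Rightarrow> real) \<Rightarrow> ereal" where
  "divergence_conjugate \<phi> P F f =
    (SUP Q \<in> MF P F. ereal (signed_integral P Q f) - enn2ereal (divergence \<phi> Q P))"

end

theory Submission
  imports Defs
begin

text \<open>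
  Young's inequality \<open>t * x - \<phi> x \<le> \<phi>\<^sup>* t\<close>, integrated with \<open>x = dQ/dP\<close> and \<open>t = f\<close>, yields one
  inequality in each of the two formulas (\<open>Fenchel_Young_integral\<close>). The content lies in the reverse
  inequalities, which both amount to exchanging a supremum with an integral.

  The exchange works because both functions are suprema of countably many lines with finite
  coefficients: \<open>\<phi>\<^sup>* t = (SUP k. r k * t - \<phi> (r k))\<close> with rational \<open>r k\<close> in the effective domain of \<open>\<phi>\<close>
  (\<open>conjugate_eq_SUP_lines\<close>), and \<open>\<phi> x = (SUP k. s k * x - \<phi>\<^sup>* (s k))\<close> with rational \<open>s k\<close> where \<open>\<phi>\<^sup>*\<close>
  is finite (\<open>divergence_function_eq_SUP_lines\<close>). The second formula rests on the biconjugate theorem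
  \<open>\<phi>\<^sup>*\<^sup>* = \<phi>\<close>, the only place where closedness of \<open>\<phi>\<close> enters. For such a supremum, the best among the
  first \<open>n\<close> lines at the point \<open>h x\<close> has an index that depends measurably on \<open>x\<close> and takes finitely
  many values. Its slope is therefore a bounded measurable function of \<open>x\<close>, and monotone convergence
  gives the integral of the supremum as the supremum of the integrals of the chosen lines
  (\<open>ereal_integral_SUP_lines\<close>).

  With \<open>h = f\<close>, the chosen slopes are bounded densities, that is, signed measures in
  \<^const>\<open>MF\<close> that nearly attain the supremum defining the conjugate (\<open>divergence_conjugate_eq\<close>). With
  \<open>h = dQ/dP\<close>, the chosen slopes are bounded test functions that nearly attain the divergence
  (\<open>divergence_dual\<close>).

  Lower semicontinuity follows, since the divergence becomes a supremum of functions of \<open>Q\<close> that are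
  \<^const>\<open>tauF\<close>-continuous up to additive constants.

  To compute with densities, every signed measure that is absolutely continuous with respect to \<open>P\<close>
  must have one (\<open>signed_Radon_Nikodym\<close>). A finite signed measure is bounded, so its upper variation
  is a finite measure; the Radon-Nikodym theorem for measures, applied to both variations, gives the
  density.
\<close>

section \<open>Convex functions as suprema of lines\<close>

lemma ennreal_convex_real:
  assumes "ennreal_convex \<phi>" "\<phi> x = ennreal p" "\<phi> y = ennreal q"
    and "0 \<le> p" "0 \<le> q" "0 \<le> u" "u \<le> 1"
  shows "\<phi> (u * x + (1 - u) * y) \<le> ennreal (u * p + (1 - u) * q)"
proof -
  have "\<phi> (u * x + (1 - u) * y) \<le> ennreal u * \<phi> x + ennreal (1 - u) * \<phi> y"
    using assms(1,6,7) unfolding ennreal_convex_def by blast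
  also have "\<dots> = ennreal (u * p + (1 - u) * q)"
    using assms by (simp add: ennreal_mult ennreal_plus)
  finally show ?thesis .
qed

text \<open>
  The reflection at \<open>1\<close> exchanges the two sides of the minimum of a divergence function, so that
  statements about points \<open>x > 1\<close> transfer to points \<open>x < 1\<close>.
\<close>
lemma ennreal_convex_reflect:
  assumes "ennreal_convex \<phi>"
  shows "ennreal_convex (\<lambda>y. \<phi> (2 - y))"
  unfolding ennreal_convex_def
proof (intro allI impI)
  fix x y u :: real
  assume "0 \<le> u" "u \<le> 1"
  then have "\<phi> (u * (2 - x) + (1 - u) * (2 - y))
      \<le> ennreal u * \<phi> (2 - x) + ennreal (1 - u) * \<phi> (2 - y)"
    using assms by (auto simp: ennreal_convex_def)
  then show "\<phi> (2 - (u * x + (1 - u) * y))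
      \<le> ennreal u * \<phi> (2 - x) + ennreal (1 - u) * \<phi> (2 - y)"
    by (simp add: algebra_simps)
qed

text \<open>
  A nonnegative convex function with value \<open>0\<close> at \<open>1\<close> is minimal there, hence increasing to the right.
\<close>
lemma ennreal_convex_mono_right:
  assumes "ennreal_convex \<phi>" "\<phi> 1 = 0" "1 \<le> x" "x \<le> y"
  shows "\<phi> x \<le> \<phi> y"
proof (cases "y = 1")
  case False
  define u where "u = (x - 1) / (y - 1)"
  have u: "0 \<le> u" "u \<le> 1" and "u * (y - 1) = x - 1"
    using assms False by (auto simp: u_def divide_simps)
  then have "u * y + (1 - u) * 1 = x"
    by (simp add: algebra_simps)
  then have "\<phi> x \<le> ennreal u * \<phi> y + ennreal (1 - u) * \<phi> 1"
    using assms(1) u unfolding ennreal_convex_def by metis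
  also have "\<dots> = ennreal u * \<phi> y"
    using \<open>\<phi> 1 = 0\<close> by simp
  also have "\<dots> \<le> 1 * \<phi> y"
    using u by (intro mult_right_mono) (auto simp: ennreal_le_1)
  finally show ?thesis
    by simp
qed (use assms in auto)

text \<open>
  Lower semicontinuity from the left at points with finite values further to the right: if \<open>\<phi> z \<le> c\<close>
  for all \<open>z\<close> just before \<open>x\<close>, then convexity on \<open>[z, w]\<close> bounds \<open>\<phi> x\<close> by a mean of \<open>c\<close> and \<open>\<phi> w\<close>
  whose weight at \<open>c\<close> tends to \<open>1\<close> as \<open>z\<close> approaches \<open>x\<close>.
\<close>
lemma ennreal_convex_lsc_before_finite:
  assumes cvx: "ennreal_convex \<phi>" and "\<phi> 1 = 0" and "1 < x" "x < w" "\<phi> w < \<infinity>"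
    and c: "ennreal c < \<phi> x" "0 \<le> c"
  shows "\<exists>z. 1 < z \<and> z < x \<and> ennreal c < \<phi> z"
proof (rule ccontr)
  assume neg: "\<not> ?thesis"
  obtain q where q: "\<phi> w = ennreal q" "0 \<le> q"
    using \<open>\<phi> w < \<infinity>\<close> by (cases "\<phi> w") auto
  have "\<phi> x \<le> \<phi> w"
    using assms by (intro ennreal_convex_mono_right) auto
  then obtain m where m: "\<phi> x = ennreal m" "0 \<le> m"
    using \<open>\<phi> w < \<infinity>\<close> by (cases "\<phi> x") (auto simp: top_unique)
  have bound: "m \<le> (w - x) / (w - z) * c + (1 - (w - x) / (w - z)) * q" if z: "1 < z" "z < x" for z
  proof -
    define u where "u = (w - x) / (w - z)"
    have u: "0 \<le> u" "u \<le> 1" and "u * (w - z) = w - x"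
      using assms z by (auto simp: u_def divide_simps)
    then have eq: "u * z + (1 - u) * w = x"
      by (simp add: algebra_simps)
    have "\<phi> z \<le> ennreal c"
      using neg z by (meson not_le)
    then obtain p where p: "\<phi> z = ennreal p" "0 \<le> p"
      by (cases "\<phi> z") (auto simp: top_unique)
    with \<open>\<phi> z \<le> ennreal c\<close> have "p \<le> c"
      using \<open>0 \<le> c\<close> by simp
    have "ennreal m \<le> ennreal (u * p + (1 - u) * q)"
      using ennreal_convex_real[OF cvx p(1) q(1) p(2) q(2) u] eq m by simp
    then have "m \<le> u * p + (1 - u) * q"
      using p q u by (subst (asm) ennreal_le_iff) auto
    also have "\<dots> \<le> u * c + (1 - u) * q"
      using \<open>p \<le> c\<close> u by (intro add_mono mult_left_mono) auto
    finally show ?thesis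
      by (simp add: u_def)
  qed
  have "((\<lambda>z. (w - x) / (w - z) * c + (1 - (w - x) / (w - z)) * q) \<longlongrightarrow>
      (w - x) / (w - x) * c + (1 - (w - x) / (w - x)) * q) (at_left x)"
    using \<open>x < w\<close> by (intro tendsto_intros) auto
  then have "((\<lambda>z. (w - x) / (w - z) * c + (1 - (w - x) / (w - z)) * q) \<longlongrightarrow> c) (at_left x)"
    using \<open>x < w\<close> by simp
  moreover have "eventually (\<lambda>z. m \<le> (w - x) / (w - z) * c + (1 - (w - x) / (w - z)) * q) (at_left x)"
    using \<open>1 < x\<close> bound by (auto simp: eventually_at_left intro!: exI[of _ 1])
  ultimately have "m \<le> c"
    by (intro tendsto_lowerbound[of _ c "at_left x"]) auto
  then show False
    using c m by (simp add: ennreal_less_iff)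
qed

text \<open>
  Let \<open>c \<le> \<phi> x\<close>. A line through \<open>(x, c)\<close> lies below \<open>\<phi>\<close> iff its slope is at least every slope
  \<open>(c - \<phi> y) / (x - y)\<close> with \<open>y < x\<close> and at most every slope \<open>(\<phi> y - c) / (y - x)\<close> with \<open>y > x\<close>.
  By convexity no lower bound exceeds an upper one, so the supremum of the
  lower bounds works, provided that it is finite. This is what \<open>z\<close> is for: points in \<open>[z, x)\<close>
  contribute negative slopes, and all others at most \<open>c / (x - z)\<close>.
\<close>
lemma ennreal_convex_support_line_right:
  assumes cvx: "ennreal_convex \<phi>" and "\<phi> 1 = 0" and z: "1 < z" "z < x"
    and cz: "ennreal c < \<phi> z" and c: "0 \<le> c"
  shows "\<exists>t. \<forall>y. ereal (c + t * (y - x)) \<le> enn2ereal (\<phi> y)"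
proof -
  have large: "ennreal c < \<phi> y" if "z \<le> y" for y
    using ennreal_convex_mono_right[OF cvx \<open>\<phi> 1 = 0\<close>, of z y] that z cz by simp
  \<comment> \<open>The slopes forced by the points to the left of \<open>x\<close>.\<close>
  define L where "L = {(c - p) / (x - y) | y p. y < x \<and> 0 \<le> p \<and> \<phi> y = ennreal p}"
  have bdd: "l \<le> c / (x - z)" if l_in: "l \<in> L" for l
  proof -
    obtain y p where l: "l = (c - p) / (x - y)" and y: "y < x" "0 \<le> p" "\<phi> y = ennreal p"
      using l_in unfolding L_def by blast
    show ?thesis
    proof (cases "z \<le> y")
      case True
      then have "c < p"
        using large[of y] y c by (simp add: ennreal_less_iff)
      then have "l \<le> 0"
        using y unfolding l by (auto simp: divide_simps)
      also have "0 \<le> c / (x - z)"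
        using z c by simp
      finally show ?thesis .
    next
      case False
      have "l \<le> c / (x - y)"
        using y by (auto simp: l divide_simps)
      also have "\<dots> \<le> c / (x - z)"
        using False z c by (intro divide_left_mono) auto
      finally show ?thesis .
    qed
  qed
  have "(c - 0) / (x - 1) \<in> L"
    using z \<open>\<phi> 1 = 0\<close> unfolding L_def by (intro CollectI exI[of _ 1] exI[of _ 0]) auto
  then have ne: "L \<noteq> {}"
    by blast
  have "ereal (c + Sup L * (y - x)) \<le> enn2ereal (\<phi> y)" for y
  proof (cases "\<phi> y")
    case (real q)
    consider "y < x" | "y = x" | "x < y"
      by linarith
    then have "c + Sup L * (y - x) \<le> q"
    proof cases
      case 1
      then have "(c - q) / (x - y) \<le> Sup L"
        using real bdd by (intro cSup_upper bdd_aboveI[of _ "c / (x - z)"]) (auto simp: L_def)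
      with 1 show ?thesis
        by (simp add: divide_simps algebra_simps)
    next
      case 2
      then show ?thesis
        using large[of x] z real c by (simp add: ennreal_less_iff)
    next
      case 3
      have "Sup L \<le> (q - c) / (y - x)"
      proof (rule cSup_least[OF ne])
        fix l assume "l \<in> L"
        then obtain y' p where l: "l = (c - p) / (x - y')" and y: "y' < x" "0 \<le> p" "\<phi> y' = ennreal p"
          unfolding L_def by blast
        define u where "u = (y - x) / (y - y')"
        have u: "0 \<le> u" "u \<le> 1" and uy: "u * (y - y') = y - x"
          using 3 y by (auto simp: u_def divide_simps)
        then have eq: "u * y' + (1 - u) * y = x"
          by (simp add: algebra_simps)
        have "ennreal c < \<phi> x"
          using large z by simp
        also have "\<dots> \<le> ennreal (u * p + (1 - u) * q)"
          using ennreal_convex_real[OF cvx y(3) real(2) y(2) real(1) u] eq by simp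
        finally have "c \<le> u * p + (1 - u) * q"
          using c by (simp add: ennreal_less_iff)
        then have "c * (y - y') \<le> (u * p + (1 - u) * q) * (y - y')"
          using 3 y by (intro mult_right_mono) auto
        also have "\<dots> = (u * (y - y')) * p + ((y - y') - u * (y - y')) * q"
          by (simp add: algebra_simps)
        also have "\<dots> = (y - x) * p + (x - y') * q"
          unfolding uy by simp
        finally have "(c - p) * (y - x) \<le> (q - c) * (x - y')"
          by (simp add: algebra_simps)
        then show "l \<le> (q - c) / (y - x)"
          using 3 y unfolding l by (simp add: divide_simps mult.commute)
      qed
      with 3 show ?thesis
        by (simp add: divide_simps algebra_simps)
    qed
    with real show ?thesis
      by simp
  qed simp
  then show ?thesis
    by blast
qed

text \<open>
  It remains to find a point \<open>z\<close> strictly between \<open>1\<close> and \<open>x\<close> with \<open>\<phi> z > c\<close>. If \<open>x\<close> lies strictly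
  before the end of the effective domain, convexity gives it; at the end it is closedness; beyond the
  end, \<open>\<phi>\<close> is infinite on an interval before \<open>x\<close>.
\<close>
lemma divergence_function_support_line:
  assumes div: "divergence_function \<phi>" and c: "0 \<le> c" "ennreal c < \<phi> x"
  shows "\<exists>t. \<forall>y. ereal (c + t * (y - x)) \<le> enn2ereal (\<phi> y)"
proof -
  have cvx: "ennreal_convex \<phi>" and one: "\<phi> 1 = 0" and closed: "closed_at_ends \<phi>"
    and ends: "lower_end \<phi> < 1" "1 < upper_end \<phi>"
    using div by (auto simp: divergence_function_def)
  have "x \<noteq> 1"
    using c one by auto
  then consider "1 < x" | "x < 1"
    by linarith
  then show ?thesis
  proof cases
    case 1
    have "\<exists>z. 1 < z \<and> z < x \<and> ennreal c < \<phi> z"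
    proof -
      consider "ereal x < upper_end \<phi>" | "upper_end \<phi> = ereal x" | "upper_end \<phi> < ereal x"
        by (metis linorder_cases)
      then show ?thesis
      proof cases
        case 1
        then obtain w where "x < w" "\<phi> w < \<infinity>"
          by (auto simp: upper_end_def eff_domain_def less_SUP_iff)
        then show ?thesis
          using ennreal_convex_lsc_before_finite[OF cvx one \<open>1 < x\<close>] c by blast
      next
        case 2
        then have "eventually (\<lambda>y. ennreal c < \<phi> y) (at_left x)"
          using closed c by (auto simp: closed_at_ends_def intro: order_tendstoD)
        then obtain b where b: "b < x" "\<And>y. b < y \<Longrightarrow> y < x \<Longrightarrow> ennreal c < \<phi> y"
          by (auto simp: eventually_at_left[OF \<open>1 < x\<close>])
        obtain z where "max b 1 < z" "z < x"
          using dense[of "max b 1" x] b \<open>1 < x\<close> by auto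
        then show ?thesis
          using b by auto
      next
        case 3
        then obtain z where z: "upper_end \<phi> < ereal z" "ereal z < ereal x"
          using ereal_dense2 by blast
        with ends have "1 < z"
          by (metis ereal_less(3) less_trans one_ereal_def less_ereal.simps(1))
        moreover have "\<phi> z = \<infinity>"
        proof (rule ccontr)
          assume "\<phi> z \<noteq> \<infinity>"
          then have "ereal z \<le> upper_end \<phi>"
            unfolding upper_end_def eff_domain_def by (intro SUP_upper) (auto simp: less_top)
          with z show False
            by simp
        qed
        ultimately show ?thesis
          using z by auto
      qed
    qed
    then show ?thesis
      using ennreal_convex_support_line_right[OF cvx one] c by blast
  next
    case 2
    have cvx': "ennreal_convex (\<lambda>y. \<phi> (2 - y))"
      by (rule ennreal_convex_reflect[OF cvx])
    have one': "\<phi> (2 - 1) = 0"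
      using one by simp
    have "\<exists>z. 1 < z \<and> z < 2 - x \<and> ennreal c < \<phi> (2 - z)"
    proof -
      consider "lower_end \<phi> < ereal x" | "lower_end \<phi> = ereal x" | "ereal x < lower_end \<phi>"
        by (metis linorder_cases)
      then show ?thesis
      proof cases
        case 1
        then obtain w where "w < x" "\<phi> w < \<infinity>"
          by (auto simp: lower_end_def eff_domain_def INF_less_iff)
        then show ?thesis
          using ennreal_convex_lsc_before_finite[OF cvx' one', of "2 - x" "2 - w" c] c \<open>x < 1\<close> by auto
      next
        case 2
        then have "eventually (\<lambda>y. ennreal c < \<phi> y) (at_right x)"
          using closed c by (auto simp: closed_at_ends_def intro: order_tendstoD)
        then obtain b where b: "x < b" "\<And>y. x < y \<Longrightarrow> y < b \<Longrightarrow> ennreal c < \<phi> y"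
          by (auto simp: eventually_at_right[OF \<open>x < 1\<close>])
        obtain z where "x < z" "z < min b 1"
          using dense[of x "min b 1"] b \<open>x < 1\<close> by auto
        then show ?thesis
          using b by (intro exI[of _ "2 - z"]) auto
      next
        case 3
        then obtain z where z: "ereal x < ereal z" "ereal z < lower_end \<phi>"
          using ereal_dense2 by blast
        with ends have "z < 1"
          by (metis less_trans one_ereal_def less_ereal.simps(1))
        moreover have "\<phi> z = \<infinity>"
        proof (rule ccontr)
          assume "\<phi> z \<noteq> \<infinity>"
          then have "lower_end \<phi> \<le> ereal z"
            unfolding lower_end_def eff_domain_def by (intro INF_lower) (auto simp: less_top)
          with z show False
            by simp
        qed
        ultimately show ?thesis
          using z by (intro exI[of _ "2 - z"]) auto
      qed
    qed
    then obtain z where "1 < z" "z < 2 - x" "ennreal c < \<phi> (2 - z)"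
      by blast
    from ennreal_convex_support_line_right[OF cvx' one' this c(1)]
    obtain t where t: "\<And>y. ereal (c + t * (y - (2 - x))) \<le> enn2ereal (\<phi> (2 - y))"
      by blast
    have "ereal (c + (- t) * (y - x)) \<le> enn2ereal (\<phi> y)" for y
      using t[of "2 - y"] by (simp add: algebra_simps)
    then show ?thesis
      by blast
  qed
qed

lemma conjugate_zero:
  assumes "\<phi> 1 = 0"
  shows "conjugate \<phi> 0 = 0"
proof (rule antisym)
  show "conjugate \<phi> 0 \<le> 0"
    unfolding conjugate_def by (auto intro!: SUP_least simp: zero_ereal_def[symmetric])
  show "0 \<le> conjugate \<phi> 0"
    using conjugate_ge[of \<phi>, OF assms, of 0] by (simp add: zero_ereal_def)
qed

lemma Fenchel_Young:
  "ereal (t * x) - enn2ereal (\<phi> x) \<le> conjugate \<phi> t"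
  unfolding conjugate_def by (rule SUP_upper) simp

text \<open>
  Every \<open>c < \<phi> x\<close> is the value at \<open>x\<close> of some line below \<open>\<phi>\<close>; if \<open>t\<close> is its slope, then
  \<open>\<phi>\<^sup>* t \<le> t * x - c\<close>.
\<close>
lemma biconjugate:
  assumes "divergence_function \<phi>"
  shows "enn2ereal (\<phi> x) = (SUP t. ereal (t * x) - conjugate \<phi> t)"
proof (rule antisym)
  have one: "\<phi> 1 = 0"
    using assms by (simp add: divergence_function_def)
  show "(SUP t. ereal (t * x) - conjugate \<phi> t) \<le> enn2ereal (\<phi> x)"
  proof (rule SUP_least)
    fix t
    show "ereal (t * x) - conjugate \<phi> t \<le> enn2ereal (\<phi> x)"
      using Fenchel_Young[of t x \<phi>] conjugate_ge[of \<phi>, OF one, of t]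
      by (cases "conjugate \<phi> t"; cases "enn2ereal (\<phi> x)") auto
  qed
  show "enn2ereal (\<phi> x) \<le> (SUP t. ereal (t * x) - conjugate \<phi> t)"
  proof (rule dense_le)
    fix e assume e: "e < enn2ereal (\<phi> x)"
    have nonneg: "0 \<le> (SUP t. ereal (t * x) - conjugate \<phi> t)"
      using conjugate_zero[of \<phi>, OF one] by (intro SUP_upper2[of 0]) (auto simp: zero_ereal_def[symmetric])
    show "e \<le> (SUP t. ereal (t * x) - conjugate \<phi> t)"
    proof (cases "e \<le> 0")
      case True
      then show ?thesis
        using nonneg by (rule order_trans)
    next
      case False
      then obtain c where c: "e = ereal c" "0 \<le> c"
        using e by (cases e) auto
      with e have "ennreal c < \<phi> x"
        by (metis enn2ereal_ennreal less_ennreal.rep_eq)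
      from divergence_function_support_line[OF assms \<open>0 \<le> c\<close> this]
      obtain t where t: "\<And>y. ereal (c + t * (y - x)) \<le> enn2ereal (\<phi> y)"
        by blast
      have "conjugate \<phi> t \<le> ereal (t * x - c)"
        unfolding conjugate_def
      proof (rule SUP_least)
        fix y
        show "ereal (t * y) - enn2ereal (\<phi> y) \<le> ereal (t * x - c)"
          using t[of y] by (cases "enn2ereal (\<phi> y)") (auto simp: algebra_simps)
      qed
      then have "e \<le> ereal (t * x) - conjugate \<phi> t"
        unfolding c by (cases "conjugate \<phi> t") auto
      then show ?thesis
        by (rule SUP_upper2[rotated]) simp
    qed
  qed
qed

text \<open>
  The rationals are dense in the segment from \<open>a\<close> to \<open>x\<close>; rationality of \<open>a\<close> covers the degenerate
  case \<open>x = a\<close>.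
\<close>
lemma rational_points_towards:
  fixes a x :: real
  assumes "a \<in> \<rat>"
  shows "\<exists>u :: nat \<Rightarrow> real. (\<forall>n. 0 \<le> u n \<and> u n \<le> 1 \<and> a + u n * (x - a) \<in> \<rat>) \<and> u \<longlonglongrightarrow> 1"
proof (cases "x = a")
  case True
  then show ?thesis
    using assms by (intro exI[of _ "\<lambda>_. 1"]) auto
next
  case False
  have "\<exists>v. 1 - inverse (real (Suc n)) \<le> v \<and> v \<le> 1 \<and> a + v * (x - a) \<in> \<rat>" for n
  proof -
    define l where "l = a + (1 - inverse (real (Suc n))) * (x - a)"
    have lx: "x - l = inverse (real (Suc n)) * (x - a)"
      by (simp add: l_def algebra_simps)
    with False have "l \<noteq> x"
      by auto
    then have "min l x < max l x"
      by auto
    then obtain q where q: "q \<in> \<rat>" "min l x < q" "q < max l x"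
      using Rats_dense_in_real by blast
    \<comment> \<open>The weight at which the rational point \<open>q\<close> lies on the segment from \<open>a\<close> to \<open>x\<close>.\<close>
    define v where "v = (q - a) / (x - a)"
    have qv: "q = a + v * (x - a)"
      using False by (simp add: v_def)
    have "(1 - v) * (x - a) = x - q" "(v - (1 - inverse (real (Suc n)))) * (x - a) = q - l"
      unfolding qv l_def by (simp_all add: algebra_simps)
    moreover have "0 < (x - q) * (x - a)" "0 < (q - l) * (x - a)"
    proof -
      have "(a < x \<longleftrightarrow> l < x)"
      proof -
        have "0 < x - l \<longleftrightarrow> 0 < x - a"
          unfolding lx by (simp add: zero_less_mult_iff)
        then show ?thesis by simp
      qed
      then show "0 < (x - q) * (x - a)" "0 < (q - l) * (x - a)"
        using q False by (auto simp: zero_less_mult_iff min_def max_def split: if_splits)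
    qed
    ultimately have "0 < (1 - v) * (x - a)\<^sup>2" "0 < (v - (1 - inverse (real (Suc n)))) * (x - a)\<^sup>2"
      by (simp_all add: power2_eq_square mult.assoc[symmetric])
    then have "v < 1" "1 - inverse (real (Suc n)) < v"
      by (auto simp: zero_less_mult_iff)
    then show ?thesis
      using q qv by (intro exI[of _ v]) auto
  qed
  then obtain u where u: "\<And>n. 1 - inverse (real (Suc n)) \<le> u n" "\<And>n. u n \<le> 1"
      "\<And>n. a + u n * (x - a) \<in> \<rat>"
    by metis
  have "u \<longlonglongrightarrow> 1"
  proof (rule tendsto_sandwich)
    show "(\<lambda>n. 1 - inverse (real (Suc n))) \<longlonglongrightarrow> 1"
      using LIMSEQ_inverse_real_of_nat_add_minus[of 1] by simp
  qed (use u in auto)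
  moreover have "0 \<le> u n" for n
  proof -
    have "inverse (real (Suc n)) \<le> 1" by (simp add: field_simps)
    then show ?thesis using u(1)[of n] by linarith
  qed
  ultimately show ?thesis
    using u by blast
qed

text \<open>
  Concavity along the segments that emanate from a single rational point \<open>a\<close> is enough to restrict
  the supremum to rational arguments: along such a segment the value at \<open>x\<close> is approached from below
  at rational points. This covers domains with empty interior, such as that of a conjugate which is
  finite only at \<open>0\<close>.
\<close>
lemma SUP_over_rationals:
  fixes W :: "real \<Rightarrow> ereal"
  assumes a: "a \<in> \<rat>" "W a = ereal \<alpha>" and fin: "\<And>x. W x \<noteq> \<infinity>"
    and star: "\<And>u x w. 0 \<le> u \<Longrightarrow> u \<le> 1 \<Longrightarrow> W x = ereal w \<Longrightarrow>
      ereal (u * w + (1 - u) * \<alpha>) \<le> W (a + u * (x - a))"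
  shows "(SUP x. W x) = (SUP r \<in> {r \<in> \<rat>. W r \<noteq> -\<infinity>}. W r)" (is "_ = ?S")
proof (rule antisym)
  show "(SUP x. W x) \<le> ?S"
  proof (rule SUP_least)
    fix x
    show "W x \<le> ?S"
    proof (cases "W x")
      case (real w)
      obtain u where u: "\<And>n. 0 \<le> u n" "\<And>n. u n \<le> 1" "\<And>n :: nat. a + u n * (x - a) \<in> \<rat>" "u \<longlonglongrightarrow> 1"
        using rational_points_towards[OF a(1)] by blast
      have "ereal (u n * w + (1 - u n) * \<alpha>) \<le> ?S" for n
      proof -
        note le = star[OF u(1)[of n] u(2)[of n] real]
        then have "W (a + u n * (x - a)) \<noteq> -\<infinity>"
          by auto
        then have "W (a + u n * (x - a)) \<le> ?S"
          using u(3)[of n] by (intro SUP_upper) auto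
        with le show ?thesis
          by (rule order_trans)
      qed
      moreover have "(\<lambda>n. ereal (u n * w + (1 - u n) * \<alpha>)) \<longlonglongrightarrow> ereal (1 * w + (1 - 1) * \<alpha>)"
        unfolding lim_ereal by (intro tendsto_intros u)
      ultimately have "ereal (1 * w + (1 - 1) * \<alpha>) \<le> ?S"
        by (intro LIMSEQ_le_const2[where a = ?S]) blast+
      then show ?thesis
        using real by simp
    qed (use fin in auto)
  qed
qed (auto intro: SUP_subset_mono)

text \<open>
  Since \<open>\<phi> 1 = 0\<close>, convexity yields \<open>\<phi> (1 + u * (x - 1)) \<le> u * \<phi> x\<close> for \<open>0 \<le> u \<le> 1\<close>, which is the
  concavity along segments from \<open>1\<close> that allows restricting the supremum to rational points.
\<close>
lemma conjugate_eq_SUP_lines: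
  assumes div: "divergence_function \<phi>"
  obtains r b :: "nat \<Rightarrow> real"
  where "\<And>k. 0 \<le> b k" and "\<And>k. \<phi> (r k) = ennreal (b k)"
    and "\<And>t. conjugate \<phi> t = (SUP k. ereal (r k * t - b k))"
proof -
  have cvx: "ennreal_convex \<phi>" and one: "\<phi> 1 = 0"
    using div by (auto simp: divergence_function_def)
  define D where "D = {x \<in> \<rat>. \<phi> x \<noteq> \<infinity>}"
  have "countable D"
    unfolding D_def by (rule countable_subset[OF _ countable_rat]) auto
  moreover have "1 \<in> D"
    using one by (simp add: D_def)
  ultimately have "range (from_nat_into D) = D"
    by (intro range_from_nat_into) auto
  then obtain r :: "nat \<Rightarrow> real" where r: "range r = D" ..
  define b where "b k = enn2real (\<phi> (r k))" for k
  have phi: "\<phi> (r k) = ennreal (b k)" for k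
    using r rangeI[of r k] by (auto simp: b_def D_def less_top)
  have b0: "0 \<le> b k" for k
    by (simp add: b_def)
  have "conjugate \<phi> t = (SUP k. ereal (r k * t - b k))" for t
  proof -
    let ?W = "\<lambda>x. ereal (t * x) - enn2ereal (\<phi> x)"
    have "(SUP x. ?W x) = (SUP x \<in> {x \<in> \<rat>. ?W x \<noteq> -\<infinity>}. ?W x)"
    proof (rule SUP_over_rationals[where a = 1 and \<alpha> = t])
      fix u x w :: real assume u: "0 \<le> u" "u \<le> 1" and w: "?W x = ereal w"
      obtain p where p: "\<phi> x = ennreal p" "0 \<le> p" "w = t * x - p"
        using w by (cases "\<phi> x") auto
      have "\<phi> (u * x + (1 - u) * 1) \<le> ennreal (u * p + (1 - u) * 0)"
        using ennreal_convex_real[OF cvx p(1), of 1 0 u] one p u by simp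
      moreover have "u * x + (1 - u) * 1 = 1 + u * (x - 1)"
        by (simp add: algebra_simps)
      ultimately have le: "\<phi> (1 + u * (x - 1)) \<le> ennreal (u * p)"
        by (metis add_0_right mult_zero_right)
      then obtain q where q: "\<phi> (1 + u * (x - 1)) = ennreal q" "0 \<le> q"
        by (cases "\<phi> (1 + u * (x - 1))") (auto simp: top_unique)
      with le have "q \<le> u * p"
        using u p by simp
      moreover have "u * w + (1 - u) * t = t * (1 + u * (x - 1)) - u * p"
        unfolding p(3) by (simp add: algebra_simps)
      ultimately show "ereal (u * w + (1 - u) * t) \<le> ?W (1 + u * (x - 1))"
        using q by simp
    next
      show "?W x \<noteq> \<infinity>" for x
        by (cases "\<phi> x") auto
    qed (use one in \<open>auto simp: zero_ennreal.rep_eq\<close>)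
    also have "{x \<in> \<rat>. ?W x \<noteq> -\<infinity>} = D"
    proof -
      have "?W x \<noteq> -\<infinity> \<longleftrightarrow> \<phi> x \<noteq> \<infinity>" for x
        by (cases "\<phi> x") auto
      then show ?thesis
        by (simp add: D_def)
    qed
    also have "(SUP x \<in> D. ?W x) = (SUP k. ?W (r k))"
      unfolding r[symmetric] by (simp add: image_image)
    also have "\<dots> = (SUP k. ereal (r k * t - b k))"
      by (simp add: phi b0 mult.commute)
    finally show ?thesis
      by (simp add: conjugate_def)
  qed
  with that phi b0 show thesis
    by blast
qed

text \<open>
  Since \<open>\<phi>\<close> is nonnegative, \<open>\<phi>\<^sup>* (u * t) \<le> u * \<phi>\<^sup>* t\<close> for \<open>0 \<le> u \<le> 1\<close>; so the supremum in the
  biconjugate theorem may be restricted to rational points, this time along segments from \<open>0\<close>.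
\<close>
lemma divergence_function_eq_SUP_lines:
  assumes div: "divergence_function \<phi>"
  obtains s b :: "nat \<Rightarrow> real"
  where "\<And>k. conjugate \<phi> (s k) = ereal (b k)"
    and "\<And>x. enn2ereal (\<phi> x) = (SUP k. ereal (s k * x - b k))"
proof -
  have one: "\<phi> 1 = 0"
    using div by (auto simp: divergence_function_def)
  have ninf: "conjugate \<phi> t \<noteq> -\<infinity>" for t
    using conjugate_ge[of \<phi>, OF one, of t] by auto
  define D where "D = {t \<in> \<rat>. conjugate \<phi> t \<noteq> \<infinity>}"
  have "countable D"
    unfolding D_def by (rule countable_subset[OF _ countable_rat]) auto
  moreover have "0 \<in> D"
    using conjugate_zero[of \<phi>, OF one] by (simp add: D_def)
  ultimately have "range (from_nat_into D) = D"
    by (intro range_from_nat_into) auto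
  then obtain s :: "nat \<Rightarrow> real" where s: "range s = D" ..
  define b where "b k = real_of_ereal (conjugate \<phi> (s k))" for k
  have conj: "conjugate \<phi> (s k) = ereal (b k)" for k
    using s rangeI[of s k] ninf[of "s k"] by (auto simp: b_def D_def ereal_real)
  have "enn2ereal (\<phi> x) = (SUP k. ereal (s k * x - b k))" for x
  proof -
    let ?W = "\<lambda>t. ereal (t * x) - conjugate \<phi> t"
    have "(SUP t. ?W t) = (SUP t \<in> {t \<in> \<rat>. ?W t \<noteq> -\<infinity>}. ?W t)"
    proof (rule SUP_over_rationals[where a = 0 and \<alpha> = 0])
      fix u t w :: real assume u: "0 \<le> u" "u \<le> 1" and w: "?W t = ereal w"
      obtain p where p: "conjugate \<phi> t = ereal p" "w = t * x - p"
        using w ninf[of t] by (cases "conjugate \<phi> t") auto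
      have "conjugate \<phi> (u * t) \<le> ereal (u * p)"
        unfolding conjugate_def
      proof (rule SUP_least)
        fix y
        show "ereal (u * t * y) - enn2ereal (\<phi> y) \<le> ereal (u * p)"
        proof (cases "\<phi> y")
          case (real q)
          have "t * y - q \<le> p"
            using Fenchel_Young[of t y \<phi>] p real by simp
          then have "u * (t * y - q) \<le> u * p"
            using u by (intro mult_left_mono) auto
          moreover have "u * q \<le> q"
            using u real by (simp add: mult_left_le_one_le)
          ultimately have "u * t * y - q \<le> u * p"
            by (simp add: algebra_simps)
          then show ?thesis
            using real by simp
        qed auto
      qed
      with ninf[of "u * t"] obtain q where q: "conjugate \<phi> (u * t) = ereal q" "q \<le> u * p"
        by (cases "conjugate \<phi> (u * t)") auto
      moreover have "u * w = u * t * x - u * p"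
        unfolding p(2) by (simp add: algebra_simps)
      ultimately show "ereal (u * w + (1 - u) * 0) \<le> ?W (0 + u * (t - 0))"
        by simp
    next
      show "?W t \<noteq> \<infinity>" for t
        using ninf[of t] by (cases "conjugate \<phi> t") auto
    qed (use conjugate_zero[of \<phi>, OF one] in \<open>auto simp: zero_ereal_def\<close>)
    also have "{t \<in> \<rat>. ?W t \<noteq> -\<infinity>} = D"
    proof -
      have "?W t \<noteq> -\<infinity> \<longleftrightarrow> conjugate \<phi> t \<noteq> \<infinity>" for t
        using ninf[of t] by (cases "conjugate \<phi> t") auto
      then show ?thesis
        by (simp add: D_def)
    qed
    also have "(SUP t \<in> D. ?W t) = (SUP k. ?W (s k))"
      unfolding s[symmetric] by (simp add: image_image)
    also have "\<dots> = (SUP k. ereal (s k * x - b k))"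
      by (simp add: conj)
    finally show ?thesis
      using biconjugate[OF div, of x] by simp
  qed
  with that conj show thesis
    by blast
qed


section \<open>Signed measures and their densities\<close>

lemma signed_measure_sums:
  assumes "Q \<in> signed_measures M" "range A \<subseteq> sets M" "disjoint_family A"
  shows "(\<lambda>i. Q (A i)) sums Q (\<Union>i :: nat. A i)"
  using assms by (auto simp: signed_measures_def)

lemma signed_measure_empty:
  assumes "Q \<in> signed_measures M"
  shows "Q {} = 0"
proof -
  have "(\<lambda>i :: nat. Q {}) sums Q (\<Union>i :: nat. {})"
    using assms by (rule signed_measure_sums) (auto simp: disjoint_family_on_def)
  then have "(\<lambda>i :: nat. Q {}) \<longlonglongrightarrow> 0"
    by (intro summable_LIMSEQ_zero) (rule sums_summable)
  then show ?thesis
    by (simp add: LIMSEQ_const_iff)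
qed

lemma signed_measure_Un:
  assumes Q: "Q \<in> signed_measures M" and "A \<in> sets M" "B \<in> sets M" "A \<inter> B = {}"
  shows "Q (A \<union> B) = Q A + Q B"
proof -
  have "(\<lambda>i. Q (binaryset A B i)) sums Q (\<Union>i. binaryset A B i)"
    using assms
    by (intro signed_measure_sums[OF Q])
       (auto simp: range_binaryset_eq disjoint_family_on_def binaryset_def)
  moreover have "(\<lambda>i. Q (binaryset A B i)) sums (Q A + Q B)"
    by (rule binaryset_sums) (rule signed_measure_empty[OF Q])
  ultimately show ?thesis
    unfolding UN_binaryset_eq by (rule sums_unique2)
qed

lemma signed_measure_Diff:
  assumes "Q \<in> signed_measures M" "A \<in> sets M" "B \<in> sets M" "B \<subseteq> A"
  shows "Q A = Q B + Q (A - B)"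
  using signed_measure_Un[of Q M B "A - B"] assms by (simp add: Un_absorb1)

lemma signed_measure_uminus:
  assumes "Q \<in> signed_measures M"
  shows "(\<lambda>A. - Q A) \<in> signed_measures M"
  using assms by (auto simp: signed_measures_def intro: sums_minus)

text \<open>
  If \<open>Q\<close> is unbounded on the measurable subsets of \<open>A\<close>, then \<open>A\<close> splits into two parts of which one is
  again unbounded in this sense, while the other has a value of absolute value at least \<open>1\<close>. Iterating
  peels off infinitely many disjoint sets whose values do not tend to \<open>0\<close>, contradicting the
  convergence of the series.
\<close>
lemma signed_measure_bounded:
  assumes Q: "Q \<in> signed_measures M"
  shows "\<exists>K. \<forall>B \<in> sets M. \<bar>Q B\<bar> \<le> K"
proof (rule ccontr)
  assume unbounded: "\<not> ?thesis"
  define big where "big A \<longleftrightarrow> A \<in> sets M \<and> (\<forall>K. \<exists>B \<in> sets M. B \<subseteq> A \<and> K < \<bar>Q B\<bar>)" for A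
  have split: "\<exists>A'. big A' \<and> (A' \<subseteq> A \<and> 1 \<le> \<bar>Q (A - A')\<bar>)" if A: "big A" for A
  proof -
    from A obtain B where B: "B \<in> sets M" "B \<subseteq> A" "\<bar>Q A\<bar> + 1 < \<bar>Q B\<bar>"
      unfolding big_def by blast
    have "A \<in> sets M"
      using A by (simp add: big_def)
    have "1 \<le> \<bar>Q (A - B)\<bar>"
      using signed_measure_Diff[OF Q \<open>A \<in> sets M\<close> B(1,2)] B(3) by linarith
    have "big B \<or> big (A - B)"
    proof (rule ccontr)
      assume "\<not> ?thesis"
      then obtain K1 K2 where K: "\<And>C. C \<in> sets M \<Longrightarrow> C \<subseteq> B \<Longrightarrow> \<bar>Q C\<bar> \<le> K1"
          "\<And>C. C \<in> sets M \<Longrightarrow> C \<subseteq> A - B \<Longrightarrow> \<bar>Q C\<bar> \<le> K2"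
        using B \<open>A \<in> sets M\<close> unfolding big_def by (metis not_le sets.Diff)
      obtain C where C: "C \<in> sets M" "C \<subseteq> A" "K1 + K2 < \<bar>Q C\<bar>"
        using A unfolding big_def by blast
      have "Q C = Q (C \<inter> B) + Q (C - C \<inter> B)"
        using C B by (intro signed_measure_Diff[OF Q]) auto
      moreover have "\<bar>Q (C \<inter> B)\<bar> \<le> K1" "\<bar>Q (C - C \<inter> B)\<bar> \<le> K2"
        using C B by (auto intro!: K)
      ultimately show False
        using C(3) by linarith
    qed
    then show ?thesis
    proof
      assume "big B"
      then show ?thesis
        using B \<open>1 \<le> \<bar>Q (A - B)\<bar>\<close> by auto
    next
      assume "big (A - B)"
      moreover have "A - (A - B) = B"
        using B by auto
      ultimately show ?thesis
        using B by (intro exI[of _ "A - B"]) auto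
    qed
  qed
  have "big (space M)"
    unfolding big_def
  proof (intro conjI allI)
    fix K
    obtain B where "B \<in> sets M" "K < \<bar>Q B\<bar>"
      using unbounded by (meson not_le)
    then show "\<exists>B \<in> sets M. B \<subseteq> space M \<and> K < \<bar>Q B\<bar>"
      using sets.sets_into_space by blast
  qed simp
  then obtain A where A: "\<And>n. big (A n)" "\<And>n. A (Suc n) \<subseteq> A n \<and> 1 \<le> \<bar>Q (A n - A (Suc n))\<bar>"
    using dependent_nat_choice[of "\<lambda>_. big" "\<lambda>_ A A'. A' \<subseteq> A \<and> 1 \<le> \<bar>Q (A - A')\<bar>"] split
    by metis
  define D where "D n = A n - A (Suc n)" for n
  have anti: "decseq A"
    using A(2) by (intro decseq_SucI) auto
  have "D m \<inter> D n = {}" if "m < n" for m n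
    using decseqD[OF anti, of "Suc m" n] that by (auto simp: D_def)
  then have "disjoint_family D"
    unfolding disjoint_family_on_def by (metis Int_commute linorder_neqE_nat)
  moreover have "range D \<subseteq> sets M"
    using A(1) by (auto simp: D_def big_def)
  ultimately have "(\<lambda>n. Q (D n)) sums Q (\<Union>n. D n)"
    by (intro signed_measure_sums[OF Q])
  then have "(\<lambda>n. Q (D n)) \<longlonglongrightarrow> 0"
    by (intro summable_LIMSEQ_zero) (rule sums_summable)
  then have "eventually (\<lambda>n. \<bar>Q (D n)\<bar> < 1) sequentially"
    using tendstoD[of "\<lambda>n. Q (D n)" 0 sequentially 1] by (simp add: dist_real_def)
  then obtain n where "\<bar>Q (D n)\<bar> < 1"
    by (auto simp: eventually_sequentially)
  then show False
    using A(2)[of n] by (simp add: D_def)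
qed

text \<open>
  The set function behind \<^const>\<open>pos_variation\<close>. Since \<^const>\<open>measure_of\<close> yields the zero measure for
  arguments that are not countably additive, countable additivity has to be proved before
  \<^const>\<open>pos_variation\<close> can be evaluated.
\<close>
definition upper_variation :: "'a measure \<Rightarrow> ('a set \<Rightarrow> real) \<Rightarrow> 'a set \<Rightarrow> ennreal" where
  "upper_variation M Q A = (SUP B \<in> {B \<in> sets M. B \<subseteq> A}. ennreal (Q B))"

lemma upper_variation_upper:
  "B \<in> sets M \<Longrightarrow> B \<subseteq> A \<Longrightarrow> ennreal (Q B) \<le> upper_variation M Q A"
  unfolding upper_variation_def by (rule SUP_upper) simp

lemma upper_variation_mono:
  "A \<subseteq> A' \<Longrightarrow> upper_variation M Q A \<le> upper_variation M Q A'"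
  unfolding upper_variation_def by (rule SUP_subset_mono) auto

text \<open>
  Sets with negative values contribute \<open>0\<close> to the supremum, so that only two nonnegative values have
  to be added.
\<close>
lemma upper_variation_superadditive:
  assumes Q: "Q \<in> signed_measures M" and disj: "A \<inter> A' = {}"
  shows "upper_variation M Q A + upper_variation M Q A' \<le> upper_variation M Q (A \<union> A')"
proof -
  have le: "ennreal (Q B) + ennreal (Q B') \<le> upper_variation M Q (A \<union> A')"
    if B: "B \<in> sets M" "B \<subseteq> A" and B': "B' \<in> sets M" "B' \<subseteq> A'" for B B'
  proof (cases "0 \<le> Q B \<and> 0 \<le> Q B'")
    case True
    have "Q (B \<union> B') = Q B + Q B'"
      using B B' disj by (intro signed_measure_Un[OF Q]) auto
    then have "ennreal (Q B) + ennreal (Q B') = ennreal (Q (B \<union> B'))"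
      using True by simp
    also have "\<dots> \<le> upper_variation M Q (A \<union> A')"
      using B B' by (intro upper_variation_upper) auto
    finally show ?thesis .
  next
    case False
    have "ennreal (Q B) \<le> upper_variation M Q (A \<union> A')" "ennreal (Q B') \<le> upper_variation M Q (A \<union> A')"
      using B B' by (auto intro!: upper_variation_upper)
    with False show ?thesis
      by (auto simp: ennreal_neg)
  qed
  have ne: "{B \<in> sets M. B \<subseteq> A} \<noteq> {}" "{B \<in> sets M. B \<subseteq> A'} \<noteq> {}"
    by blast+
  have "ennreal (Q B) + upper_variation M Q A' \<le> upper_variation M Q (A \<union> A')"
    if "B \<in> sets M" "B \<subseteq> A" for B
    unfolding upper_variation_def[of M Q A']
    by (subst ennreal_SUP_add_right, rule ne(2)) (intro SUP_least, use le that in auto)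
  then show ?thesis
    unfolding upper_variation_def[of M Q A]
    by (subst ennreal_SUP_add_left[OF ne(1), symmetric]) (intro SUP_least, auto)
qed

lemma ennreal_le_suminf_of_sums:
  assumes "x sums s"
  shows "ennreal s \<le> (\<Sum>i. ennreal (x i))"
proof (rule LIMSEQ_le_const2)
  show "(\<lambda>n. ennreal (\<Sum>i<n. x i)) \<longlonglongrightarrow> ennreal s"
    using assms unfolding sums_def by (rule tendsto_ennrealI)
  have "ennreal (\<Sum>i<n. x i) \<le> (\<Sum>i. ennreal (x i))" for n
  proof -
    have "ennreal (\<Sum>i<n. x i) \<le> ennreal (\<Sum>i<n. max 0 (x i))"
      by (intro ennreal_leI sum_mono) auto
    also have "\<dots> = (\<Sum>i<n. ennreal (max 0 (x i)))"
      by (subst sum_ennreal) auto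
    also have "\<dots> = (\<Sum>i<n. ennreal (x i))"
      by (intro sum.cong refl) (simp add: max_def ennreal_neg)
    also have "\<dots> \<le> (\<Sum>i. ennreal (x i))"
      by (intro sum_le_suminf) auto
    finally show ?thesis .
  qed
  then show "\<exists>N. \<forall>n\<ge>N. ennreal (\<Sum>i<n. x i) \<le> (\<Sum>i. ennreal (x i))"
    by blast
qed

text \<open>
  For the upper bound, a competitor \<open>B\<close> is cut along the sets \<open>A i\<close>; the lower bound is
  superadditivity on finite subfamilies.
\<close>
lemma upper_variation_countably_additive:
  assumes Q: "Q \<in> signed_measures M"
  shows "countably_additive (sets M) (upper_variation M Q)"
  unfolding countably_additive_def
proof (intro allI impI antisym)
  fix A :: "nat \<Rightarrow> 'a set"
  assume A: "range A \<subseteq> sets M" "disjoint_family A"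
  show "upper_variation M Q (\<Union>i. A i) \<le> (\<Sum>i. upper_variation M Q (A i))"
    unfolding upper_variation_def[of M Q "\<Union>i. A i"]
  proof (rule SUP_least)
    fix B assume "B \<in> {B \<in> sets M. B \<subseteq> (\<Union>i. A i)}"
    then have B: "B \<in> sets M" "B = (\<Union>i. B \<inter> A i)"
      by auto
    have "(\<lambda>i. Q (B \<inter> A i)) sums Q (\<Union>i. B \<inter> A i)"
      using A B(1) by (intro signed_measure_sums[OF Q]) (auto simp: disjoint_family_on_def)
    then have "ennreal (Q B) \<le> (\<Sum>i. ennreal (Q (B \<inter> A i)))"
      using B(2) by (metis ennreal_le_suminf_of_sums)
    also have "\<dots> \<le> (\<Sum>i. upper_variation M Q (A i))"
      using A B(1) by (intro suminf_le upper_variation_upper) auto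
    finally show "ennreal (Q B) \<le> (\<Sum>i. upper_variation M Q (A i))" .
  qed
  show "(\<Sum>i. upper_variation M Q (A i)) \<le> upper_variation M Q (\<Union>i. A i)"
  proof (rule suminf_le_const)
    fix n
    have "(\<Sum>i<n. upper_variation M Q (A i)) \<le> upper_variation M Q (\<Union>i<n. A i)"
    proof (induction n)
      case (Suc n)
      have "A i \<inter> A n = {}" if "i < n" for i
        using A(2) that by (auto simp: disjoint_family_on_def)
      then have "(\<Union>i<n. A i) \<inter> A n = {}"
        by blast
      then have "upper_variation M Q (\<Union>i<n. A i) + upper_variation M Q (A n)
          \<le> upper_variation M Q ((\<Union>i<n. A i) \<union> A n)"
        by (rule upper_variation_superadditive[OF Q])
      moreover have "(\<Union>i<n. A i) \<union> A n = (\<Union>i<Suc n. A i)"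
        by (auto simp: lessThan_Suc)
      ultimately show ?case
        using Suc.IH by (auto intro: order_trans add_mono)
    qed simp
    also have "\<dots> \<le> upper_variation M Q (\<Union>i. A i)"
      by (rule upper_variation_mono) auto
    finally show "(\<Sum>i<n. upper_variation M Q (A i)) \<le> upper_variation M Q (\<Union>i. A i)" .
  qed simp
qed

lemma sets_pos_variation [simp]: "sets (pos_variation M Q) = sets M"
  and space_pos_variation [simp]: "space (pos_variation M Q) = space M"
  by (auto simp: pos_variation_def)

lemma neg_variation_eq_pos_variation: "neg_variation M Q = pos_variation M (\<lambda>A. - Q A)"
  by (simp add: neg_variation_def pos_variation_def)

lemma emeasure_pos_variation:
  assumes Q: "Q \<in> signed_measures M" and "A \<in> sets M"
  shows "emeasure (pos_variation M Q) A = upper_variation M Q A"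
proof -
  have "positive (sets M) (upper_variation M Q)"
    unfolding positive_def upper_variation_def
    using signed_measure_empty[OF Q] by (simp add: subset_empty conj_commute cong: conj_cong)
  then have "emeasure (measure_of (space M) (sets M) (upper_variation M Q)) A = upper_variation M Q A"
    using upper_variation_countably_additive[OF Q] \<open>A \<in> sets M\<close>
    by (intro emeasure_measure_of_sigma sets.sigma_algebra_axioms)
  then show ?thesis
    by (simp add: pos_variation_def upper_variation_def[abs_def])
qed

lemma finite_measure_pos_variation:
  assumes Q: "Q \<in> signed_measures M"
  shows "finite_measure (pos_variation M Q)"
proof (rule finite_measureI)
  obtain K where K: "\<And>B. B \<in> sets M \<Longrightarrow> \<bar>Q B\<bar> \<le> K"
    using signed_measure_bounded[OF Q] by blast
  have "emeasure (pos_variation M Q) (space M) \<le> ennreal K"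
    unfolding emeasure_pos_variation[OF Q sets.top] upper_variation_def
  proof (intro SUP_least ennreal_leI)
    show "Q B \<le> K" if "B \<in> {B \<in> sets M. B \<subseteq> space M}" for B
      using K[of B] that by auto
  qed
  then show "emeasure (pos_variation M Q) (space (pos_variation M Q)) \<noteq> \<infinity>"
    by (auto simp: top_unique)
qed

text \<open>
  Passing from \<open>B\<close> to its complement \<open>A - B\<close> turns \<open>Q B\<close> into \<open>Q A - Q (A - B)\<close>, so the upper variation
  of \<open>A\<close> exceeds the lower variation by \<open>Q A\<close>.
\<close>
lemma Jordan_decomposition:
  assumes Q: "Q \<in> signed_measures M" and A: "A \<in> sets M"
  shows "Q A = measure (pos_variation M Q) A - measure (neg_variation M Q) A"
proof -
  have le: "measure (pos_variation M R) A \<le> R A + measure (pos_variation M (\<lambda>A. - R A)) A"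
    if R: "R \<in> signed_measures M" for R
  proof -
    interpret p: finite_measure "pos_variation M R"
      by (rule finite_measure_pos_variation[OF R])
    interpret n: finite_measure "pos_variation M (\<lambda>A. - R A)"
      by (rule finite_measure_pos_variation[OF signed_measure_uminus[OF R]])
    let ?q = "measure (pos_variation M (\<lambda>A. - R A)) A"
    have bound: "R B \<le> R A + ?q" if B: "B \<in> sets M" "B \<subseteq> A" for B
    proof -
      have "ennreal (- R (A - B)) \<le> upper_variation M (\<lambda>A. - R A) A"
        using A B by (intro upper_variation_upper[where Q = "\<lambda>A. - R A"]) auto
      also have "\<dots> = ennreal ?q"
        using emeasure_pos_variation[OF signed_measure_uminus[OF R] A] n.emeasure_eq_measure[of A] by simp
      finally have "- R (A - B) \<le> ?q"
        by (subst (asm) ennreal_le_iff) (rule measure_nonneg)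
      then show ?thesis
        using signed_measure_Diff[OF R A B] by simp
    qed
    have "0 \<le> R A + ?q"
      using bound[of "{}"] signed_measure_empty[OF R] by simp
    have "ennreal (measure (pos_variation M R) A) \<le> ennreal (R A + ?q)"
      unfolding p.emeasure_eq_measure[symmetric] emeasure_pos_variation[OF R A] upper_variation_def
      by (intro SUP_least ennreal_leI bound) auto
    then show ?thesis
      using \<open>0 \<le> R A + ?q\<close> by (simp add: ennreal_le_iff)
  qed
  show ?thesis
    using le[OF Q] le[OF signed_measure_uminus[OF Q]]
    by (simp add: neg_variation_eq_pos_variation)
qed

lemma (in finite_measure) finite_ac_measure_real_density:
  assumes N: "finite_measure N" "absolutely_continuous M N" "sets N = sets M"
  shows "\<exists>g. integrable M g \<and> (\<forall>A \<in> sets M. measure N A = (LINT x:A|M. g x))"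
proof -
  interpret N: finite_measure N by fact
  obtain D where D [measurable]: "D \<in> borel_measurable M"
    and RN: "AE x in M. RN_deriv M N x = ennreal (D x)" and pos: "\<And>x. 0 \<le> D x"
    using real_RN_deriv[OF N] by blast
  have "N = density M (RN_deriv M N)"
    using density_RN_deriv[OF N(2,3)] by simp
  also have "\<dots> = density M (\<lambda>x. ennreal (D x))"
    using RN by (intro density_cong) auto
  finally have eq: "N = density M (\<lambda>x. ennreal (D x))" .
  have emeasure: "emeasure N A = (\<integral>\<^sup>+ x. ennreal (D x * indicator A x) \<partial>M)" if "A \<in> sets M" for A
    using that pos
    by (subst eq) (auto simp: emeasure_density ennreal_mult' ennreal_indicator intro!: nn_integral_cong)
  have "(\<integral>\<^sup>+ x. ennreal (D x) \<partial>M) = emeasure N (space M)"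
    unfolding emeasure[OF sets.top] by (intro nn_integral_cong) auto
  then have "integrable M D"
    using pos N.emeasure_finite[of "space M"] by (intro integrableI_nonneg) (auto simp: less_top[symmetric])
  moreover have "measure N A = (LINT x:A|M. D x)" if "A \<in> sets M" for A
  proof -
    have "(LINT x:A|M. D x) = integral\<^sup>L M (\<lambda>x. D x * indicator A x)"
      by (simp add: set_lebesgue_integral_def mult.commute)
    also have "\<dots> = enn2real (\<integral>\<^sup>+ x. ennreal (D x * indicator A x) \<partial>M)"
      using that pos by (intro integral_eq_nn_integral) auto
    finally show ?thesis
      by (simp add: emeasure[OF that, symmetric] measure_def)
  qed
  ultimately show ?thesis
    by blast
qed

lemma pos_variation_absolutely_continuous:
  assumes "Q \<in> ac_signed_measures P"
  shows "absolutely_continuous P (pos_variation P Q)"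
  unfolding absolutely_continuous_def
proof
  fix A assume A: "A \<in> null_sets P"
  then have "Q B = 0" if "B \<in> sets P" "B \<subseteq> A" for B
    using assms that null_sets_subset[OF A that] by (auto simp: ac_signed_measures_def)
  then have "upper_variation P Q A = 0"
    by (auto simp: upper_variation_def intro!: antisym SUP_least)
  then show "A \<in> null_sets (pos_variation P Q)"
    using assms A emeasure_pos_variation[of Q P A] by (auto simp: ac_signed_measures_def null_sets_def)
qed

text \<open>
  The densities of the two variations differ by a density of \<open>Q\<close>; hence the choice made in
  \<^const>\<open>signed_RN_deriv\<close> is not vacuous.
\<close>
lemma (in finite_measure) signed_Radon_Nikodym:
  assumes Q: "Q \<in> ac_signed_measures M"
  shows "integrable M (signed_RN_deriv M Q)"
    and "A \<in> sets M \<Longrightarrow> Q A = (LINT x:A|M. signed_RN_deriv M Q x)"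
proof -
  have sQ: "Q \<in> signed_measures M"
    using Q by (simp add: ac_signed_measures_def)
  have Q': "(\<lambda>A. - Q A) \<in> ac_signed_measures M"
    using Q signed_measure_uminus[OF sQ] by (auto simp: ac_signed_measures_def)
  obtain g where g: "integrable M g" "\<And>A. A \<in> sets M \<Longrightarrow> measure (pos_variation M Q) A = (LINT x:A|M. g x)"
    using finite_ac_measure_real_density[OF finite_measure_pos_variation[OF sQ]
      pos_variation_absolutely_continuous[OF Q]] by auto
  obtain h where h: "integrable M h" "\<And>A. A \<in> sets M \<Longrightarrow> measure (neg_variation M Q) A = (LINT x:A|M. h x)"
    using finite_ac_measure_real_density[OF finite_measure_pos_variation[OF signed_measure_uminus[OF sQ]]
      pos_variation_absolutely_continuous[OF Q']] by (auto simp: neg_variation_eq_pos_variation)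
  have "Q A = (LINT x:A|M. (g x - h x))" if "A \<in> sets M" for A
    using that g h Jordan_decomposition[OF sQ that]
    by (simp add: set_integral_diff(2) set_integrable_def integrable_mult_indicator
        del: real_scaleR_def)
  then have "integrable M (\<lambda>x. g x - h x) \<and> (\<forall>A \<in> sets M. Q A = (LINT x:A|M. (g x - h x)))"
    using g h by auto
  then have "\<exists>k. integrable M k \<and> (\<forall>A \<in> sets M. Q A = (LINT x:A|M. k x))"
    by (intro exI[of _ "\<lambda>x. g x - h x"])
  then have "integrable M (signed_RN_deriv M Q) \<and>
      (\<forall>A \<in> sets M. Q A = (LINT x:A|M. signed_RN_deriv M Q x))"
    unfolding signed_RN_deriv_def by (rule someI_ex)
  then show "integrable M (signed_RN_deriv M Q)"
    and "A \<in> sets M \<Longrightarrow> Q A = (LINT x:A|M. signed_RN_deriv M Q x)"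
    by auto
qed

lemma measure_of_eq_density:
  assumes "\<And>A. A \<in> sets M \<Longrightarrow> \<mu> A = emeasure (density M h) A"
  shows "measure_of (space M) (sets M) \<mu> = density M h"
proof -
  have "measure_of (space M) (sets M) \<mu> = measure_of (space M) (sets M) (emeasure (density M h))"
    using assms by (intro measure_of_eq sets.space_closed) (simp add: sets.sigma_sets_eq)
  also have "\<dots> = measure_of (space (density M h)) (sets (density M h)) (emeasure (density M h))"
    by simp
  also have "\<dots> = density M h"
    by (rule measure_of_of_measure)
  finally show ?thesis .
qed

text \<open>
  Among the subsets of \<open>A\<close>, the part where the density is nonnegative has the largest value. The
  coercion \<^const>\<open>ennreal\<close> already takes the positive part of \<open>g\<close>.
\<close>
lemma pos_variation_eq_density:
  assumes g: "integrable M g" and Q: "\<And>A. A \<in> sets M \<Longrightarrow> Q A = (LINT x:A|M. g x)"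
  shows "pos_variation M Q = density M (\<lambda>x. ennreal (g x))"
  unfolding pos_variation_def
proof (rule measure_of_eq_density, rule antisym)
  have [measurable]: "g \<in> borel_measurable M"
    using g by simp
  fix A assume A [measurable]: "A \<in> sets M"
  have nn: "ennreal (LINT x:B|M. max 0 (g x)) = emeasure (density M (\<lambda>x. ennreal (g x))) B"
    if B [measurable]: "B \<in> sets M" for B
  proof -
    have "(LINT x:B|M. max 0 (g x)) = integral\<^sup>L M (\<lambda>x. indicator B x * max 0 (g x))"
      by (simp add: set_lebesgue_integral_def)
    also have "ennreal \<dots> = (\<integral>\<^sup>+ x. ennreal (indicator B x * max 0 (g x)) \<partial>M)"
      using integrable_mult_indicator[OF B integrable_max[OF integrable_zero g]]
      by (intro nn_integral_eq_integral[symmetric]) auto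
    also have "\<dots> = (\<integral>\<^sup>+ x. ennreal (g x) * indicator B x \<partial>M)"
      by (intro nn_integral_cong) (auto simp: indicator_def max_def ennreal_neg)
    finally show ?thesis
      by (simp add: emeasure_density)
  qed
  show "(SUP B \<in> {B \<in> sets M. B \<subseteq> A}. ennreal (Q B)) \<le> emeasure (density M (\<lambda>x. ennreal (g x))) A"
  proof (rule SUP_least)
    fix B assume "B \<in> {B \<in> sets M. B \<subseteq> A}"
    then have B [measurable]: "B \<in> sets M" and "B \<subseteq> A"
      by auto
    have "Q B \<le> (LINT x:B|M. max 0 (g x))"
      unfolding Q[OF B] set_lebesgue_integral_def
      using integrable_mult_indicator[OF B g]
        integrable_mult_indicator[OF B integrable_max[OF integrable_zero g]]
      by (intro integral_mono) (auto simp: indicator_def)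
    then have "ennreal (Q B) \<le> emeasure (density M (\<lambda>x. ennreal (g x))) B"
      unfolding nn[OF B, symmetric] by (rule ennreal_leI)
    also have "\<dots> \<le> emeasure (density M (\<lambda>x. ennreal (g x))) A"
      using \<open>B \<subseteq> A\<close> by (intro emeasure_mono) auto
    finally show "ennreal (Q B) \<le> emeasure (density M (\<lambda>x. ennreal (g x))) A" .
  qed
  define B where "B = {x \<in> space M. 0 \<le> g x} \<inter> A"
  have B: "B \<in> sets M"
    unfolding B_def by measurable
  have "emeasure (density M (\<lambda>x. ennreal (g x))) A = ennreal (LINT x:A|M. max 0 (g x))"
    by (rule nn[OF A, symmetric])
  also have "(LINT x:A|M. max 0 (g x)) = Q B"
    unfolding Q[OF B] set_lebesgue_integral_def
    unfolding B_def
    by (intro Bochner_Integration.integral_cong) (auto simp: indicator_def max_def)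
  finally show "emeasure (density M (\<lambda>x. ennreal (g x))) A \<le> (SUP B \<in> {B \<in> sets M. B \<subseteq> A}. ennreal (Q B))"
    using B by (auto intro!: SUP_upper simp: B_def)
qed

context finite_measure
begin

lemma pos_variation_ac:
  assumes "Q \<in> ac_signed_measures M"
  shows "pos_variation M Q = density M (\<lambda>x. ennreal (signed_RN_deriv M Q x))"
  using signed_Radon_Nikodym[OF assms] by (rule pos_variation_eq_density)

lemma neg_variation_ac:
  assumes "Q \<in> ac_signed_measures M"
  shows "neg_variation M Q = density M (\<lambda>x. ennreal (- signed_RN_deriv M Q x))"
  unfolding neg_variation_eq_pos_variation
  using signed_Radon_Nikodym[OF assms]
  by (intro pos_variation_eq_density) (auto simp: set_lebesgue_integral_def)

lemma total_variation_ac: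
  assumes Q: "Q \<in> ac_signed_measures M"
  shows "total_variation M Q = density M (\<lambda>x. ennreal \<bar>signed_RN_deriv M Q x\<bar>)"
  unfolding total_variation_def
proof (rule measure_of_eq_density)
  fix A assume A [measurable]: "A \<in> sets M"
  have [measurable]: "signed_RN_deriv M Q \<in> borel_measurable M"
    using signed_Radon_Nikodym[OF Q] by simp
  have "ennreal t + ennreal (- t) = ennreal \<bar>t\<bar>" for t
    by (simp add: abs_if ennreal_neg)
  then show "emeasure (pos_variation M Q) A + emeasure (neg_variation M Q) A
      = emeasure (density M (\<lambda>x. ennreal \<bar>signed_RN_deriv M Q x\<bar>)) A"
    unfolding pos_variation_ac[OF Q] neg_variation_ac[OF Q]
    by (simp add: emeasure_density nn_integral_add[symmetric] distrib_right[symmetric])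
qed

lemma signed_integral_ac:
  assumes Q: "Q \<in> ac_signed_measures M" and f [measurable]: "f \<in> borel_measurable M"
    and int: "integrable M (\<lambda>x. signed_RN_deriv M Q x * f x)"
  shows "signed_integral M Q f = (\<integral>x. signed_RN_deriv M Q x * f x \<partial>M)"
proof -
  let ?g = "signed_RN_deriv M Q"
  have [measurable]: "?g \<in> borel_measurable M"
    using signed_Radon_Nikodym[OF Q] by simp
  have pos: "ennreal t = ennreal (max 0 t)" for t
    by (simp add: max_def ennreal_neg)
  have eq: "integral\<^sup>L (density M (\<lambda>x. ennreal (h x))) f = (\<integral>x. max 0 (h x) * f x \<partial>M)"
    if [measurable]: "h \<in> borel_measurable M" for h
    unfolding pos[of "h _"] by (subst integral_density) auto
  have bound: "integrable M (\<lambda>x. max 0 (s * ?g x) * f x)" if "\<bar>s\<bar> = 1" for s :: real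
  proof (rule Bochner_Integration.integrable_bound[OF int])
    have "\<bar>max 0 (s * ?g x)\<bar> \<le> \<bar>?g x\<bar>" for x
      using that abs_mult[of s "?g x"] by simp
    then show "AE x in M. norm (max 0 (s * ?g x) * f x) \<le> norm (?g x * f x)"
      by (auto simp: abs_mult intro!: mult_right_mono)
  qed simp
  have "signed_integral M Q f = (\<integral>x. max 0 (?g x) * f x \<partial>M) - (\<integral>x. max 0 (- ?g x) * f x \<partial>M)"
    unfolding signed_integral_def pos_variation_ac[OF Q] neg_variation_ac[OF Q] by (simp add: eq)
  also have "\<dots> = (\<integral>x. max 0 (?g x) * f x - max 0 (- ?g x) * f x \<partial>M)"
    using bound[of 1] bound[of "-1"] by (subst Bochner_Integration.integral_diff) auto
  also have "\<dots> = (\<integral>x. ?g x * f x \<partial>M)"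
    by (intro Bochner_Integration.integral_cong) (auto simp: max_def)
  finally show ?thesis .
qed

text \<open>
  The value \<open>0\<close> off \<^term>\<open>sets M\<close> is the normalization required in \<^const>\<open>signed_measures\<close>.
\<close>
definition signed_density :: "('a \<Rightarrow> real) \<Rightarrow> 'a set \<Rightarrow> real" where
  "signed_density g A = (if A \<in> sets M then (LINT x:A|M. g x) else 0)"

lemma signed_density_ac:
  assumes g: "integrable M g"
  shows "signed_density g \<in> ac_signed_measures M"
proof -
  have set_int: "set_integrable M A g" if "A \<in> sets M" for A
    using integrable_mult_indicator[OF that g] by (simp add: set_integrable_def)
  have "(\<lambda>i. signed_density g (A i)) sums signed_density g (\<Union>i. A i)"
    if A: "range A \<subseteq> sets M" "disjoint_family A" for A :: "nat \<Rightarrow> 'a set"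
  proof -
    have fin: "(\<Sum>i<n. signed_density g (A i)) = (LINT x:(\<Union>i<n. A i)|M. g x)" for n
    proof -
      have "(LINT x:(\<Union>i<n. A i)|M. g x) = (\<Sum>i<n. LINT x:A i|M. g x)"
        using A set_int
        by (intro set_integral_finite_Union) (auto simp: disjoint_family_on_def)
      then show ?thesis
        using A(1) by (auto simp: signed_density_def intro!: sum.cong)
    qed
    have "(\<lambda>n. LINT x:(\<Union>i<n. A i)|M. g x) \<longlonglongrightarrow> (LINT x:(\<Union>n. \<Union>i<n. A i)|M. g x)"
    proof (rule set_integral_cont_up)
      show "incseq (\<lambda>n. \<Union>i<n. A i)"
        by (intro incseq_SucI) (auto simp: lessThan_Suc)
    qed (use A in \<open>auto intro!: set_int sets.countable_UN\<close>)
    moreover have "(\<Union>n. \<Union>i<n. A i) = (\<Union>i. A i)"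
      by auto
    moreover have "(\<Union>i. A i) \<in> sets M"
      using A(1) by auto
    ultimately show ?thesis
      unfolding sums_def fin by (simp add: signed_density_def)
  qed
  moreover have "signed_density g A = 0" if "A \<in> null_sets M" for A
    using that
    by (auto simp: signed_density_def set_lebesgue_integral_def intro!: integral_eq_zero_AE
        elim!: AE_mp[OF AE_not_in])
  ultimately show ?thesis
    by (auto simp: ac_signed_measures_def signed_measures_def) (auto simp: signed_density_def)
qed

lemma signed_RN_deriv_signed_density:
  assumes g: "integrable M g"
  shows "AE x in M. signed_RN_deriv M (signed_density g) x = g x"
proof (rule density_unique_real)
  show "integrable M (signed_RN_deriv M (signed_density g))"
    by (rule signed_Radon_Nikodym(1)[OF signed_density_ac[OF g]])
  show "(LINT x:A|M. signed_RN_deriv M (signed_density g) x) = (LINT x:A|M. g x)"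
    if "A \<in> sets M" for A
    using signed_Radon_Nikodym(2)[OF signed_density_ac[OF g] that] that
    by (simp add: signed_density_def)
qed (rule g)

end


section \<open>Extended-real integrals and monotone convergence\<close>

text \<open>
  Subtracting an integrable minorant reduces \<^const>\<open>ereal_integral\<close> to an integral of a nonnegative
  function. The identity between positive and negative parts is first arranged as an equation
  between sums in \<^typ>\<open>ennreal\<close>, where integration is additive without further conditions.
\<close>
lemma ereal_integral_shift:
  assumes l: "integrable M l" and h [measurable]: "h \<in> borel_measurable M"
    and le: "AE x in M. ereal (l x) \<le> h x"
  shows "ereal_integral M h =
    ereal (integral\<^sup>L M l) + enn2ereal (\<integral>\<^sup>+ x. e2ennreal (h x - ereal (l x)) \<partial>M)"
proof -
  have [measurable]: "l \<in> borel_measurable M"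
    using l by simp
  \<comment> \<open>Positive and negative parts of \<open>y = (y - t) + t\<close>, with the negative parts moved across.\<close>
  have balance: "e2ennreal y + ennreal (- t) = e2ennreal (y - ereal t) + ennreal t + e2ennreal (- y)"
    if "ereal t \<le> y" for y t
  proof (cases y)
    case (real r)
    with that have "t \<le> r"
      by simp
    then show ?thesis
      unfolding real
      by (cases "0 \<le> r"; cases "0 \<le> t") (auto simp: ennreal_neg simp flip: ennreal_plus)
  qed (use that in auto)
  let ?hp = "\<integral>\<^sup>+ x. e2ennreal (h x) \<partial>M" and ?hn = "\<integral>\<^sup>+ x. e2ennreal (- h x) \<partial>M"
  let ?lp = "\<integral>\<^sup>+ x. ennreal (l x) \<partial>M" and ?ln = "\<integral>\<^sup>+ x. ennreal (- l x) \<partial>M"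
  let ?d = "\<integral>\<^sup>+ x. e2ennreal (h x - ereal (l x)) \<partial>M"
  have "(\<integral>\<^sup>+ x. e2ennreal (h x) + ennreal (- l x) \<partial>M)
      = (\<integral>\<^sup>+ x. e2ennreal (h x - ereal (l x)) + ennreal (l x) + e2ennreal (- h x) \<partial>M)"
    using le by (intro nn_integral_cong_AE) (auto simp: balance elim!: eventually_mono)
  then have eq: "?hp + ?ln = ?d + ?lp + ?hn"
    by (simp add: nn_integral_add)
  have "?hn \<le> ?ln"
  proof (rule nn_integral_mono_AE, use le in eventually_elim)
    case (elim x)
    then have "- h x \<le> ereal (- l x)"
      by (cases "h x") auto
    then show ?case
      using e2ennreal_mono by fastforce
  qed
  moreover have "?lp < \<infinity>" "?ln < \<infinity>"
    using l by (auto simp: real_integrable_def less_top)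
  ultimately have "?lp \<noteq> top" "?ln \<noteq> top" "?hn \<noteq> top"
    by auto
  then obtain p n k where fin: "?lp = ennreal p" "?ln = ennreal n" "?hn = ennreal k"
    and nn: "0 \<le> p" "0 \<le> n" "0 \<le> k"
    by (cases ?lp; cases ?ln; cases ?hn) blast+
  have int: "integral\<^sup>L M l = p - n"
    using real_lebesgue_integral_def[OF l] fin nn by simp
  show ?thesis
  proof (cases ?d)
    case (real d)
    have "?hp \<noteq> top"
      using eq real fin nn by (auto simp flip: ennreal_plus)
    then obtain q where q: "?hp = ennreal q" "0 \<le> q"
      by (cases ?hp) auto
    have "ennreal (q + n) = ennreal (d + p + k)"
      using eq unfolding q(1) fin real(2) using q real nn by simp
    then have "q + n = d + p + k"
      using q real nn by (subst (asm) ennreal_inj) auto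
    then show ?thesis
      unfolding ereal_integral_def int fin q(1) real(2) using q real nn by simp
  next
    case top
    then have "?hp = top"
      using eq fin by (cases ?hp) (auto simp flip: ennreal_plus)
    then show ?thesis
      unfolding ereal_integral_def int fin top using nn by simp
  qed
qed

lemma ereal_integral_ge:
  assumes "integrable M l" "h \<in> borel_measurable M" "AE x in M. ereal (l x) \<le> h x"
  shows "ereal (integral\<^sup>L M l) \<le> ereal_integral M h"
  unfolding ereal_integral_shift[OF assms] by (cases "\<integral>\<^sup>+ x. e2ennreal (h x - ereal (l x)) \<partial>M") auto

lemma ereal_integral_ereal:
  assumes "integrable M l"
  shows "ereal_integral M (\<lambda>x. ereal (l x)) = ereal (integral\<^sup>L M l)"
  using ereal_integral_shift[OF assms, of "\<lambda>x. ereal (l x)"] assms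
  by (simp add: zero_ennreal.rep_eq)

lemma ereal_integral_enn2ereal:
  "ereal_integral M (\<lambda>x. enn2ereal (k x)) = enn2ereal (\<integral>\<^sup>+ x. k x \<partial>M)"
proof -
  have "e2ennreal (- enn2ereal (k x)) = 0" for x
    by (intro e2ennreal_neg) simp
  then show ?thesis
    by (simp add: ereal_integral_def zero_ennreal.rep_eq)
qed

text \<open>
  Monotone convergence applies to the nonnegative differences \<open>w n - w 0\<close>.
\<close>
lemma ereal_integral_monotone_SUP:
  assumes int: "\<And>n. integrable M (w n)" and inc: "\<And>x. incseq (\<lambda>n. w n x)"
  shows "ereal_integral M (\<lambda>x. SUP n. ereal (w n x)) = (SUP n. ereal (integral\<^sup>L M (w n)))"
proof -
  have [measurable]: "w n \<in> borel_measurable M" for n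
    using int[of n] by simp
  let ?h = "\<lambda>x. SUP n. ereal (w n x)"
  have lim: "(\<lambda>n. ennreal (w n x - w 0 x)) \<longlonglongrightarrow> e2ennreal (?h x - ereal (w 0 x))" for x
  proof -
    have "(\<lambda>n. ereal (w n x)) \<longlonglongrightarrow> ?h x"
      using inc[of x] by (intro LIMSEQ_SUP) (auto simp: incseq_def)
    then have "(\<lambda>n. ereal (w n x) + ereal (- w 0 x)) \<longlonglongrightarrow> ?h x + ereal (- w 0 x)"
      by (intro tendsto_add_ereal_general tendsto_const) auto
    then have "(\<lambda>n. e2ennreal (ereal (w n x) + ereal (- w 0 x))) \<longlonglongrightarrow> e2ennreal (?h x + ereal (- w 0 x))"
      by (rule tendsto_e2ennrealI)
    moreover have "?h x + ereal (- w 0 x) = ?h x - ereal (w 0 x)"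
      by (cases "?h x") auto
    ultimately show ?thesis
      by simp
  qed
  have "incseq (\<lambda>n x. ennreal (w n x - w 0 x))"
    using inc by (auto simp: incseq_def le_fun_def intro!: ennreal_leI)
  then have "(\<lambda>n. \<integral>\<^sup>+ x. ennreal (w n x - w 0 x) \<partial>M) \<longlonglongrightarrow> (\<integral>\<^sup>+ x. e2ennreal (?h x - ereal (w 0 x)) \<partial>M)"
    by (rule nn_integral_LIMSEQ) (use lim in auto)
  moreover have "(\<integral>\<^sup>+ x. ennreal (w n x - w 0 x) \<partial>M) = ennreal (integral\<^sup>L M (w n) - integral\<^sup>L M (w 0))" for n
  proof -
    have "0 \<le> w n x - w 0 x" for x
      using incseqD[OF inc[of x], of 0 n] by simp
    then show ?thesis
      using int by (subst nn_integral_eq_integral) auto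
  qed
  moreover have mono: "integral\<^sup>L M (w m) \<le> integral\<^sup>L M (w n)" if "m \<le> n" for m n
    using int incseqD[OF inc that] by (intro integral_mono) auto
  ultimately have "(\<lambda>n. enn2ereal (ennreal (integral\<^sup>L M (w n) - integral\<^sup>L M (w 0))))
      \<longlonglongrightarrow> enn2ereal (\<integral>\<^sup>+ x. e2ennreal (?h x - ereal (w 0 x)) \<partial>M)"
    by (intro tendsto_enn2erealI) simp
  then have "(\<lambda>n. ereal (integral\<^sup>L M (w 0)) + ereal (integral\<^sup>L M (w n) - integral\<^sup>L M (w 0)))
      \<longlonglongrightarrow> ereal (integral\<^sup>L M (w 0)) + enn2ereal (\<integral>\<^sup>+ x. e2ennreal (?h x - ereal (w 0 x)) \<partial>M)"
    using mono by (intro tendsto_add_ereal_general tendsto_const) auto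
  also have "ereal (integral\<^sup>L M (w 0)) + enn2ereal (\<integral>\<^sup>+ x. e2ennreal (?h x - ereal (w 0 x)) \<partial>M) = ereal_integral M ?h"
    by (intro ereal_integral_shift[symmetric] int) (auto intro!: SUP_upper2[of 0])
  finally have "(\<lambda>n. ereal (integral\<^sup>L M (w n))) \<longlonglongrightarrow> ereal_integral M ?h"
    by simp
  moreover have "(\<lambda>n. ereal (integral\<^sup>L M (w n))) \<longlonglongrightarrow> (SUP n. ereal (integral\<^sup>L M (w n)))"
    using mono by (intro LIMSEQ_SUP) (auto simp: incseq_def)
  ultimately show ?thesis
    by (rule LIMSEQ_unique)
qed

section \<open>Measurable choice of the best line\<close>

text \<open>
  The least index among \<open>0, \<dots>, n\<close> that maximizes \<open>a k * s - b k\<close>. Since candidates are replaced only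
  on strict improvement, the recursion is a measurable case distinction.
\<close>
primrec best_line :: "(nat \<Rightarrow> real) \<Rightarrow> (nat \<Rightarrow> real) \<Rightarrow> nat \<Rightarrow> real \<Rightarrow> nat" where
  "best_line a b 0 s = 0"
| "best_line a b (Suc n) s =
    (if a (best_line a b n s) * s - b (best_line a b n s) < a (Suc n) * s - b (Suc n)
     then Suc n else best_line a b n s)"

lemma best_line_le: "best_line a b n s \<le> n"
  by (induction n) auto

lemma best_line_optimal:
  "k \<le> n \<Longrightarrow> a k * s - b k \<le> a (best_line a b n s) * s - b (best_line a b n s)"
proof (induction n)
  case (Suc n)
  then show ?case
    by (cases "k = Suc n") (auto simp: le_Suc_eq intro: order_trans less_imp_le)
qed simp

lemma best_line_incseq: "incseq (\<lambda>n. a (best_line a b n s) * s - b (best_line a b n s))"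
  by (rule incseq_SucI) auto

lemma SUP_best_line:
  "(SUP n. ereal (a (best_line a b n s) * s - b (best_line a b n s))) = (SUP k. ereal (a k * s - b k))"
proof (rule antisym)
  show "(SUP k. ereal (a k * s - b k)) \<le> (SUP n. ereal (a (best_line a b n s) * s - b (best_line a b n s)))"
    using best_line_optimal[of k k a s b for k] by (intro SUP_mono) auto
qed (auto intro!: SUP_least SUP_upper)

lemma measurable_best_line [measurable]: "best_line a b n \<in> borel \<rightarrow>\<^sub>M count_space UNIV"
proof (induction n)
  case (Suc n)
  note [measurable] = Suc.IH
  have [measurable]: "c \<in> count_space UNIV \<rightarrow>\<^sub>M borel" for c :: "nat \<Rightarrow> real"
    by simp
  have "(\<lambda>s. if a (best_line a b n s) * s - b (best_line a b n s) < a (Suc n) * s - b (Suc n)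
     then Suc n else best_line a b n s) \<in> borel \<rightarrow>\<^sub>M count_space UNIV"
    by measurable
  then show ?case
    by (simp cong: measurable_cong)
qed simp

lemma best_line_bounded:
  fixes a c :: "nat \<Rightarrow> real"
  shows "\<bar>c (best_line a b n s)\<bar> \<le> (\<Sum>k\<le>n. \<bar>c k\<bar>)"
  by (rule member_le_sum) (auto simp: best_line_le)

lemma (in finite_measure) integrable_best_line:
  assumes h [measurable]: "h \<in> borel_measurable M"
  shows "integrable M (\<lambda>x. c (best_line a b n (h x)) :: real)"
proof (rule integrable_const_bound)
  have [measurable]: "c \<in> count_space UNIV \<rightarrow>\<^sub>M borel"
    by simp
  show "(\<lambda>x. c (best_line a b n (h x))) \<in> borel_measurable M"
    by measurable
qed (use best_line_bounded[of c a b n] in auto)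

lemma integrable_bounded_mult:
  fixes f g :: "'a \<Rightarrow> real"
  assumes g: "integrable M g" and f: "f \<in> borel_measurable M" "\<And>x. x \<in> space M \<Longrightarrow> \<bar>f x\<bar> \<le> C"
  shows "integrable M (\<lambda>x. g x * f x)"
proof (rule Bochner_Integration.integrable_bound)
  show "integrable M (\<lambda>x. C * g x)"
    using g by simp
  have "\<bar>g x * f x\<bar> \<le> \<bar>C * g x\<bar>" if "x \<in> space M" for x
    using f(2)[OF that] by (simp add: abs_mult mult.commute[of "\<bar>g x\<bar>"] mult_right_mono)
  then show "AE x in M. norm (g x * f x) \<le> norm (C * g x)"
    by auto
qed (use assms in auto)

text \<open>
  This exchanges supremum and integral. For each \<open>n\<close> the slopes and intercepts of the chosen lines
  take finitely many values, so the chosen lines inherit integrability from \<open>h\<close>.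
\<close>
lemma (in finite_measure) ereal_integral_SUP_lines:
  assumes h: "integrable M h"
  shows "ereal_integral M (\<lambda>x. SUP k. ereal (a k * h x - b k)) =
    (SUP n. ereal (\<integral>x. a (best_line a b n (h x)) * h x - b (best_line a b n (h x)) \<partial>M))"
proof -
  have [measurable]: "h \<in> borel_measurable M"
    using h by simp
  have "integrable M (\<lambda>x. h x * a (best_line a b n (h x)))" for n
    using integrable_best_line[of h a a b n] best_line_bounded[of a a b n]
    by (intro integrable_bounded_mult[OF h]) auto
  then show ?thesis
    unfolding SUP_best_line[of a b, symmetric]
    by (intro ereal_integral_monotone_SUP best_line_incseq Bochner_Integration.integrable_diff
        integrable_best_line) (simp_all add: mult.commute)
qed

section \<open>Test functions and duality\<close>

lemma bounded_measurable_test_function: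
  "f \<in> bounded_measurable P \<Longrightarrow> f \<in> test_functions P F"
  unfolding test_functions_def by (intro fun_space.span_base) simp

lemma test_functions_induct [consumes 1, case_names zero step]:
  assumes "f \<in> test_functions P F"
    and "R (\<lambda>x. 0)"
    and "\<And>c f g. f \<in> F \<union> bounded_measurable P \<Longrightarrow> g \<in> test_functions P F \<Longrightarrow> R g \<Longrightarrow> R (\<lambda>x. c * f x + g x)"
  shows "R f"
proof -
  have "f \<in> test_functions P F \<and> R f"
    using assms(1) unfolding test_functions_def
  proof (induction rule: fun_space.span_induct_alt)
    case base
    then show ?case
      using assms(2) fun_space.span_zero by (simp add: zero_fun_def)
  next
    case (step c f g)
    have "(\<lambda>x. c * f x) + g \<in> fun_space.span (F \<union> bounded_measurable P)"
      using step by (intro fun_space.span_add fun_space.span_scale[OF fun_space.span_base]) auto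
    moreover have "R (\<lambda>x. c * f x + g x)"
      using step by (intro assms(3)) (auto simp: test_functions_def)
    ultimately show ?case
      by (simp add: plus_fun_def)
  qed
  then show ?thesis ..
qed

locale phi_divergence = prob_space P for P :: "'a measure" +
  fixes \<phi> :: "real \<Rightarrow> ennreal" and F :: "('a \<Rightarrow> real) set"
  assumes phi: "divergence_function \<phi>"
    and F_measurable: "F \<subseteq> borel_measurable P"
    and F_integrable: "\<forall>f \<in> F. (\<integral>\<^sup>+ x. ennreal \<bar>f x\<bar> \<partial>P) < \<infinity>"
begin

lemma phi_one: "\<phi> 1 = 0"
  using phi by (simp add: divergence_function_def)

lemma measurable_phi [measurable]: "\<phi> \<in> borel_measurable borel"
proof -
  obtain s b :: "nat \<Rightarrow> real" where eq: "\<And>x. enn2ereal (\<phi> x) = (SUP k. ereal (s k * x - b k))"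
    by (rule divergence_function_eq_SUP_lines[OF phi]) (rule that)
  have "(\<lambda>x. e2ennreal (SUP k. ereal (s k * x - b k))) \<in> borel_measurable borel"
    by measurable
  then show ?thesis
    unfolding eq[symmetric] e2ennreal_enn2ereal .
qed

lemma measurable_conjugate [measurable]: "conjugate \<phi> \<in> borel_measurable borel"
proof -
  obtain r b :: "nat \<Rightarrow> real" where eq: "\<And>t. conjugate \<phi> t = (SUP k. ereal (r k * t - b k))"
    by (rule conjugate_eq_SUP_lines[OF phi]) (rule that)
  have "(\<lambda>t. SUP k. ereal (r k * t - b k)) \<in> borel_measurable borel"
    by measurable
  then show ?thesis
    unfolding eq[symmetric] .
qed

text \<open>
  Integrability passes from the generators to their span. The instance \<open>g = 1\<close> concerns \<open>P\<close> itself,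
  the instance \<open>g = dQ/dP\<close> the signed measure \<open>Q\<close>.
\<close>
lemma test_function_integrable_mult:
  assumes "f \<in> test_functions P F" "integrable P g" "\<And>f. f \<in> F \<Longrightarrow> integrable P (\<lambda>x. g x * f x)"
  shows "f \<in> borel_measurable P \<and> integrable P (\<lambda>x. g x * f x)"
  using assms(1)
proof (induction rule: test_functions_induct)
  case (step c f h)
  have "f \<in> borel_measurable P \<and> integrable P (\<lambda>x. g x * f x)"
    using step(1)
  proof
    assume "f \<in> F"
    then show ?thesis
      using F_measurable assms(3) by auto
  next
    assume "f \<in> bounded_measurable P"
    then obtain C where "f \<in> borel_measurable P" "\<And>x. x \<in> space P \<Longrightarrow> \<bar>f x\<bar> \<le> C"
      by (auto simp: bounded_measurable_def)
    then show ?thesis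
      using integrable_bounded_mult[OF assms(2)] by blast
  qed
  then have "integrable P (\<lambda>x. c * (g x * f x) + g x * h x)"
    using step by auto
  moreover have "(\<lambda>x. c * (g x * f x) + g x * h x) = (\<lambda>x. g x * (c * f x + h x))"
    by (simp add: algebra_simps)
  ultimately show ?case
    using step \<open>f \<in> borel_measurable P \<and> _\<close> by auto
qed simp

lemma test_function_integrable:
  assumes "f \<in> test_functions P F"
  shows "f \<in> borel_measurable P" "integrable P f"
proof -
  have "integrable P f" if "f \<in> F" for f
    using that F_measurable F_integrable by (auto simp: integrable_iff_bounded)
  then show "f \<in> borel_measurable P" "integrable P f"
    using test_function_integrable_mult[OF assms, of "\<lambda>_. 1"] by auto
qed

abbreviation RN :: "('a set \<Rightarrow> real) \<Rightarrow> 'a \<Rightarrow> real" where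
  "RN \<equiv> signed_RN_deriv P"

lemma MF_iff:
  assumes "Q \<in> ac_signed_measures P"
  shows "Q \<in> MF P F \<longleftrightarrow> (\<forall>f \<in> F. integrable P (\<lambda>x. RN Q x * f x))"
proof -
  have [measurable]: "RN Q \<in> borel_measurable P"
    using signed_Radon_Nikodym(1)[OF assms] by simp
  have "(\<integral>\<^sup>+ x. ennreal \<bar>f x\<bar> \<partial>total_variation P Q) < \<infinity> \<longleftrightarrow> integrable P (\<lambda>x. RN Q x * f x)"
    if "f \<in> F" for f
  proof -
    have [measurable]: "f \<in> borel_measurable P"
      using that F_measurable by auto
    show ?thesis
      unfolding total_variation_ac[OF assms]
      by (simp add: nn_integral_density integrable_iff_bounded abs_mult ennreal_mult)
  qed
  then show ?thesis
    using assms by (auto simp: MF_def)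
qed

lemma MF_test_function:
  assumes "Q \<in> MF P F" "f \<in> test_functions P F"
  shows "integrable P (\<lambda>x. RN Q x * f x)"
    and "signed_integral P Q f = (\<integral>x. RN Q x * f x \<partial>P)"
proof -
  have ac: "Q \<in> ac_signed_measures P"
    using assms(1) by (simp add: MF_def)
  show int: "integrable P (\<lambda>x. RN Q x * f x)"
    using test_function_integrable_mult[OF assms(2) signed_Radon_Nikodym(1)[OF ac]] MF_iff[OF ac] assms(1)
    by auto
  show "signed_integral P Q f = (\<integral>x. RN Q x * f x \<partial>P)"
    using test_function_integrable(1)[OF assms(2)] int by (rule signed_integral_ac[OF ac])
qed

text \<open>
  Multiplication by a bounded function preserves the \<open>P\<close>-integrability of the elements of \<open>F\<close>; this is
  where the integrability assumption on \<open>F\<close> guarantees that \<^const>\<open>MF\<close> is large enough.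
\<close>
lemma signed_density_bounded:
  assumes g: "g \<in> bounded_measurable P"
  shows "signed_density g \<in> MF P F"
    and "divergence \<phi> (signed_density g) P = (\<integral>\<^sup>+ x. \<phi> (g x) \<partial>P)"
    and "f \<in> test_functions P F \<Longrightarrow> signed_integral P (signed_density g) f = (\<integral>x. g x * f x \<partial>P)"
proof -
  obtain C where g_meas [measurable]: "g \<in> borel_measurable P" and C: "\<And>x. x \<in> space P \<Longrightarrow> \<bar>g x\<bar> \<le> C"
    using g by (auto simp: bounded_measurable_def)
  have g_int: "integrable P g"
    using C by (intro integrable_const_bound[of _ C]) auto
  note ac = signed_density_ac[OF g_int] and eq = signed_RN_deriv_signed_density[OF g_int]
  have [measurable]: "RN (signed_density g) \<in> borel_measurable P"
    using signed_Radon_Nikodym(1)[OF ac] by simp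
  have "integrable P (\<lambda>x. RN (signed_density g) x * f x)" if "f \<in> F" for f
  proof -
    have f: "integrable P f"
      using that test_function_integrable(2)[of f] fun_space.span_base[of f "F \<union> bounded_measurable P"]
      by (auto simp: test_functions_def)
    then have [measurable]: "f \<in> borel_measurable P"
      by simp
    have "integrable P (\<lambda>x. f x * g x)"
      using f g_meas C by (rule integrable_bounded_mult)
    then show ?thesis
      by (rule integrable_cong_AE_imp) (use eq in auto)
  qed
  then show MF: "signed_density g \<in> MF P F"
    by (simp add: MF_iff[OF ac])
  show "divergence \<phi> (signed_density g) P = (\<integral>\<^sup>+ x. \<phi> (g x) \<partial>P)"
    unfolding divergence_def using eq by (intro nn_integral_cong_AE) auto
  assume f: "f \<in> test_functions P F"
  note [measurable] = test_function_integrable(1)[OF f]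
  show "signed_integral P (signed_density g) f = (\<integral>x. g x * f x \<partial>P)"
    unfolding MF_test_function(2)[OF MF f] using eq by (intro integral_cong_AE) auto
qed

lemma ereal_integral_conjugate_ge:
  assumes "f \<in> test_functions P F"
  shows "ereal (integral\<^sup>L P f) \<le> ereal_integral P (\<lambda>x. conjugate \<phi> (f x))"
  using test_function_integrable[OF assms] conjugate_ge[of \<phi>, OF phi_one]
  by (intro ereal_integral_ge) auto

text \<open>
  If the divergence is finite, then \<open>f * dQ/dP - \<phi> (dQ/dP)\<close> is an integrable function that lies below
  \<open>\<phi>\<^sup>* \<circ> f\<close> almost everywhere.
\<close>
lemma Fenchel_Young_integral:
  assumes Q: "Q \<in> MF P F" and f: "f \<in> test_functions P F"
  shows "ereal (signed_integral P Q f) - enn2ereal (divergence \<phi> Q P)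
    \<le> ereal_integral P (\<lambda>x. conjugate \<phi> (f x))"
proof (cases "divergence \<phi> Q P = \<infinity>")
  case False
  have ac: "Q \<in> ac_signed_measures P"
    using Q by (simp add: MF_def)
  have [measurable]: "RN Q \<in> borel_measurable P" "f \<in> borel_measurable P"
    using signed_Radon_Nikodym(1)[OF ac] test_function_integrable(1)[OF f] by auto
  let ?p = "\<lambda>x. enn2real (\<phi> (RN Q x))"
  have AE_fin: "AE x in P. \<phi> (RN Q x) \<noteq> \<infinity>"
    using False unfolding divergence_def by (intro nn_integral_PInf_AE) auto
  have eq: "(\<integral>\<^sup>+ x. ennreal (?p x) \<partial>P) = divergence \<phi> Q P"
    unfolding divergence_def using AE_fin
    by (intro nn_integral_cong_AE) (auto simp: less_top elim!: eventually_mono)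
  have p: "integrable P ?p"
    using False eq by (intro integrableI_nonneg) (auto simp: less_top)
  have "ennreal (integral\<^sup>L P ?p) = divergence \<phi> Q P"
    using nn_integral_eq_integral[OF p] eq by simp
  then have "enn2ereal (divergence \<phi> Q P) = ereal (integral\<^sup>L P ?p)"
    by (metis enn2ereal_ennreal enn2real_nonneg integral_nonneg_AE always_eventually)
  then have "ereal (signed_integral P Q f) - enn2ereal (divergence \<phi> Q P)
      = ereal (\<integral>x. RN Q x * f x - ?p x \<partial>P)"
    using MF_test_function[OF Q f] p by simp
  also have "\<dots> \<le> ereal_integral P (\<lambda>x. conjugate \<phi> (f x))"
  proof (rule ereal_integral_ge)
    show "AE x in P. ereal (RN Q x * f x - ?p x) \<le> conjugate \<phi> (f x)"
      using AE_fin
    proof eventually_elim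
      case (elim x)
      then have "enn2ereal (\<phi> (RN Q x)) = ereal (?p x)"
        by (cases "\<phi> (RN Q x)") auto
      then show ?case
        using Fenchel_Young[of "f x" "RN Q x" \<phi>] by (simp add: mult.commute)
    qed
  qed (use MF_test_function[OF Q f] p in auto)
  finally show ?thesis .
qed simp

text \<open>
  The slopes of the lines that make up \<open>\<phi>\<^sup>*\<close> are points of the effective domain of \<open>\<phi>\<close>, so choosing
  the best slope at each \<open>f x\<close> defines a bounded density with finite divergence.
\<close>
theorem divergence_conjugate_eq:
  assumes f: "f \<in> test_functions P F"
  shows "divergence_conjugate \<phi> P F f = ereal_integral P (\<lambda>x. conjugate \<phi> (f x))"
proof (rule antisym)
  show "divergence_conjugate \<phi> P F f \<le> ereal_integral P (\<lambda>x. conjugate \<phi> (f x))"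
    unfolding divergence_conjugate_def by (intro SUP_least Fenchel_Young_integral f)
  note f_int = test_function_integrable[OF f]
  note [measurable] = f_int(1)
  obtain r b :: "nat \<Rightarrow> real" where b: "\<And>k. 0 \<le> b k" "\<And>k. \<phi> (r k) = ennreal (b k)"
    and conj: "\<And>t. conjugate \<phi> t = (SUP k. ereal (r k * t - b k))"
    by (rule conjugate_eq_SUP_lines[OF phi]) (rule that)
  have "ereal (\<integral>x. r (best_line r b n (f x)) * f x - b (best_line r b n (f x)) \<partial>P)
      \<le> divergence_conjugate \<phi> P F f" for n
  proof -
    let ?g = "\<lambda>x. r (best_line r b n (f x))" and ?b = "\<lambda>x. b (best_line r b n (f x))"
    have int: "integrable P ?g" "integrable P ?b"
      by (auto intro!: integrable_best_line)
    have g: "?g \<in> bounded_measurable P"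
      using int(1) best_line_bounded[of r r b n] by (auto simp: bounded_measurable_def)
    have "integrable P (\<lambda>x. ?g x * f x)"
      using integrable_bounded_mult[OF f_int(2), of ?g] best_line_bounded[of r r b n] int(1)
      by (auto simp: mult.commute)
    moreover have "divergence \<phi> (signed_density ?g) P = ennreal (integral\<^sup>L P ?b)"
      unfolding signed_density_bounded(2)[OF g] b using int(2) b(1)
      by (intro nn_integral_eq_integral) auto
    ultimately have "ereal (\<integral>x. ?g x * f x - ?b x \<partial>P)
        = ereal (signed_integral P (signed_density ?g) f) - enn2ereal (divergence \<phi> (signed_density ?g) P)"
      using signed_density_bounded(3)[OF g f] int b(1) by simp
    also have "\<dots> \<le> divergence_conjugate \<phi> P F f"
      unfolding divergence_conjugate_def by (rule SUP_upper) (rule signed_density_bounded(1)[OF g])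
    finally show ?thesis .
  qed
  then show "ereal_integral P (\<lambda>x. conjugate \<phi> (f x)) \<le> divergence_conjugate \<phi> P F f"
    unfolding conj ereal_integral_SUP_lines[OF f_int(2)] by (intro SUP_least)
qed

text \<open>
  The slopes of the lines that make up \<open>\<phi>\<close> are points where \<open>\<phi>\<^sup>*\<close> is finite, so choosing the best slope
  at each value of \<open>dQ/dP\<close> defines a bounded test function.
\<close>
theorem divergence_dual:
  assumes Q: "Q \<in> MF P F"
  shows "enn2ereal (divergence \<phi> Q P) =
    (SUP f \<in> test_functions P F.
      ereal (signed_integral P Q f) - ereal_integral P (\<lambda>x. conjugate \<phi> (f x)))" (is "_ = ?S")
proof (rule antisym)
  show "?S \<le> enn2ereal (divergence \<phi> Q P)"
  proof (rule SUP_least)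
    fix f assume f: "f \<in> test_functions P F"
    show "ereal (signed_integral P Q f) - ereal_integral P (\<lambda>x. conjugate \<phi> (f x))
        \<le> enn2ereal (divergence \<phi> Q P)"
      using Fenchel_Young_integral[OF Q f] ereal_integral_conjugate_ge[OF f]
      by (cases "ereal_integral P (\<lambda>x. conjugate \<phi> (f x))"; cases "enn2ereal (divergence \<phi> Q P)") auto
  qed
  have g: "integrable P (RN Q)"
    using Q by (intro signed_Radon_Nikodym) (simp add: MF_def)
  then have [measurable]: "RN Q \<in> borel_measurable P"
    by simp
  obtain s b :: "nat \<Rightarrow> real" where b: "\<And>k. conjugate \<phi> (s k) = ereal (b k)"
    and eq: "\<And>x. enn2ereal (\<phi> x) = (SUP k. ereal (s k * x - b k))"
    by (rule divergence_function_eq_SUP_lines[OF phi]) (rule that)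
  have "ereal (\<integral>x. s (best_line s b n (RN Q x)) * RN Q x - b (best_line s b n (RN Q x)) \<partial>P) \<le> ?S" for n
  proof -
    let ?f = "\<lambda>x. s (best_line s b n (RN Q x))" and ?b = "\<lambda>x. b (best_line s b n (RN Q x))"
    have int: "integrable P ?f" "integrable P ?b"
      by (auto intro!: integrable_best_line)
    have "?f \<in> bounded_measurable P"
      using int(1) best_line_bounded[of s s b n] by (auto simp: bounded_measurable_def)
    then have f: "?f \<in> test_functions P F"
      by (rule bounded_measurable_test_function)
    have "ereal_integral P (\<lambda>x. conjugate \<phi> (?f x)) = ereal (integral\<^sup>L P ?b)"
      unfolding b using int(2) by (rule ereal_integral_ereal)
    then have "ereal (\<integral>x. ?f x * RN Q x - ?b x \<partial>P)
        = ereal (signed_integral P Q ?f) - ereal_integral P (\<lambda>x. conjugate \<phi> (?f x))"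
      using MF_test_function[OF Q f] int by (simp add: mult.commute)
    also have "\<dots> \<le> ?S"
      using f by (rule SUP_upper)
    finally show ?thesis .
  qed
  then show "enn2ereal (divergence \<phi> Q P) \<le> ?S"
    unfolding divergence_def ereal_integral_enn2ereal[symmetric] eq ereal_integral_SUP_lines[OF g]
    by (intro SUP_least)
qed

text \<open>
  The topology is generated by the integrals of the generators alone; continuity extends to their
  span because the integral is linear in the test function.
\<close>
lemma continuous_signed_integral:
  assumes "f \<in> test_functions P F"
  shows "continuous_map (tauF P F) euclideanreal (\<lambda>Q. signed_integral P Q f)"
  using assms
proof (induction rule: test_functions_induct)
  case zero
  then show ?case
    by (simp add: signed_integral_def)
next
  case (step c f g)
  have f: "f \<in> test_functions P F"
    using step(1) by (auto simp: test_functions_def intro: fun_space.span_base)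
  have "continuous_map (tauF P F) euclideanreal (\<lambda>Q. signed_integral P Q f)"
    unfolding continuous_map_def topspace_tauF
  proof (intro conjI allI impI)
    fix U :: "real set" assume "openin euclidean U"
    then have "{Q \<in> MF P F. signed_integral P Q f \<in> U} \<in>
        {{Q \<in> MF P F. signed_integral P Q f \<in> U} | f U. f \<in> F \<union> bounded_measurable P \<and> open U}"
      using step(1) by auto
    then show "openin (tauF P F) {Q \<in> MF P F. signed_integral P Q f \<in> U}"
      unfolding tauF_def by (rule topology_generated_by_Basis)
  qed simp
  then have "continuous_map (tauF P F) euclideanreal (\<lambda>Q. c * signed_integral P Q f + signed_integral P Q g)"
    using step by (intro continuous_map_add continuous_map_real_mult_left)
  moreover have "c * signed_integral P Q f + signed_integral P Q g = signed_integral P Q (\<lambda>x. c * f x + g x)"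
    if Q: "Q \<in> MF P F" for Q
  proof -
    have "(\<lambda>x. c * f x) + g \<in> test_functions P F"
      using f step(2) unfolding test_functions_def
      by (intro fun_space.span_add fun_space.span_scale)
    then have "(\<lambda>x. c * f x + g x) \<in> test_functions P F"
      by (simp add: plus_fun_def)
    from MF_test_function(2)[OF Q this]
    have "signed_integral P Q (\<lambda>x. c * f x + g x) = (\<integral>x. c * (RN Q x * f x) + RN Q x * g x \<partial>P)"
      by (simp add: algebra_simps)
    then show ?thesis
      using MF_test_function[OF Q f] MF_test_function[OF Q step(2)] by simp
  qed
  ultimately show ?case
    by (rule continuous_map_eq) (simp add: topspace_tauF)
qed

text \<open>
  Each superlevel set is a union of the corresponding sets for the continuous functions of \<open>Q\<close> in the
  dual representation; test functions with \<open>\<integral> \<phi>\<^sup>*(f) dP = \<infinity>\<close> contribute nothing.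
\<close>
theorem lower_semicontinuous_divergence:
  "lower_semicontinuous_map (tauF P F) (\<lambda>Q. divergence \<phi> Q P)"
  unfolding lower_semicontinuous_map_def topspace_tauF
proof
  fix c
  let ?I = "\<lambda>f. ereal_integral P (\<lambda>x. conjugate \<phi> (f x))"
  let ?U = "\<lambda>f. {Q \<in> MF P F. enn2ereal c < ereal (signed_integral P Q f) - ?I f}"
  have "c < divergence \<phi> Q P \<longleftrightarrow> (\<exists>f \<in> test_functions P F. Q \<in> ?U f)" if "Q \<in> MF P F" for Q
    using that unfolding less_ennreal.rep_eq divergence_dual[OF that] less_SUP_iff by auto
  then have "{Q \<in> MF P F. c < divergence \<phi> Q P} = (\<Union>f \<in> test_functions P F. ?U f)"
    by auto
  moreover have "openin (tauF P F) (?U f)" if f: "f \<in> test_functions P F" for f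
  proof (cases "\<exists>a b. ?I f = ereal a \<and> enn2ereal c = ereal b")
    case True
    then obtain a b where ab: "?I f = ereal a" "enn2ereal c = ereal b"
      by blast
    have "?U f = {Q \<in> topspace (tauF P F). signed_integral P Q f \<in> {a + b<..}}"
      unfolding ab topspace_tauF by (auto simp: algebra_simps)
    also have "openin (tauF P F) \<dots>"
      using continuous_signed_integral[OF f] by (rule openin_continuous_map_preimage) auto
    finally show ?thesis .
  next
    case False
    have "?I f \<noteq> -\<infinity>"
      using ereal_integral_conjugate_ge[OF f] by auto
    with False have "?U f = {}"
      by (cases "?I f"; cases c) auto
    then show ?thesis
      by (metis openin_empty)
  qed
  ultimately show "openin (tauF P F) {Q \<in> MF P F. c < divergence \<phi> Q P}"
    by (auto intro: openin_Union)
qed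

end

theorem theorem4p8:
  fixes P :: "'a measure" and \<phi> :: "real \<Rightarrow> ennreal" and F :: "('a \<Rightarrow> real) set"
  assumes "prob_space P"
    and "divergence_function \<phi>"
    and "F \<subseteq> borel_measurable P"
    and "\<forall>f \<in> F. (\<integral>\<^sup>+ x. ennreal \<bar>f x\<bar> \<partial>P) < \<infinity>"
  shows "(\<forall>f \<in> test_functions P F. divergence_conjugate \<phi> P F f \<noteq> -\<infinity>) \<and>
     (\<exists>f \<in> test_functions P F. divergence_conjugate \<phi> P F f < \<infinity>) \<and>
     (\<forall>f \<in> test_functions P F.
        divergence_conjugate \<phi> P F f = ereal_integral P (\<lambda>x. conjugate \<phi> (f x))) \<and>
     (\<forall>Q \<in> MF P F.
        enn2ereal (divergence \<phi> Q P) =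
          (SUP f \<in> test_functions P F.
             ereal (signed_integral P Q f) - ereal_integral P (\<lambda>x. conjugate \<phi> (f x)))) \<and>
     lower_semicontinuous_map (tauF P F) (\<lambda>Q. divergence \<phi> Q P)"
proof -
  interpret phi_divergence P \<phi> F
    using assms by (simp add: phi_divergence_def phi_divergence_axioms_def)
  have "divergence_conjugate \<phi> P F f \<noteq> -\<infinity>" if "f \<in> test_functions P F" for f
    using ereal_integral_conjugate_ge[OF that] unfolding divergence_conjugate_eq[OF that] by auto
  moreover have "\<exists>f \<in> test_functions P F. divergence_conjugate \<phi> P F f < \<infinity>"
  proof
    show zero: "(\<lambda>x. 0) \<in> test_functions P F"
      by (intro bounded_measurable_test_function) (auto simp: bounded_measurable_def)
    show "divergence_conjugate \<phi> P F (\<lambda>x. 0) < \<infinity>"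
      unfolding divergence_conjugate_eq[OF zero] conjugate_zero[of \<phi>, OF phi_one]
      using ereal_integral_ereal[of P "\<lambda>x. 0"] by (simp add: zero_ereal_def)
  qed
  ultimately show ?thesis
    using divergence_conjugate_eq divergence_dual lower_semicontinuous_divergence by blast
qed

end
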